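(* There exist sequences $\{\mathcal{A}_k\}_{k=1}^{\infty}$ of labyrinth patterns, each of which is both horizontally and vertically blocked, such that the limit set (mixed labyrinth fractal) $L_\infty$ defined by $\{\mathcal{A}_k\}_{k=1}^{\infty}$ has the property that for any two (distinct) points in $L_\infty$ the length of the arc $a\subset L_\infty$ that connects them is infinite.
   Context: For an integer $m\ge 1$ let $S_{i,j,m}=\{(x,y)\mid \frac{i}{m}\le x\le\frac{i+1}{m},\ \frac{j}{m}\le y\le \frac{j+1}{m}\}$ and $\mathcal{S}_m=\{S_{i,j,m}\mid 0\le i\le m-1,\ 0\le j\le m-1\}$. A nonempty $\mathcal{A}\subseteq\mathcal{S}_m$ is called an $m$-pattern and $m$ its width; the elements of $\mathcal{A}$ are its white squares and those of $\mathcal{S}_m\setminus\mathcal{A}$ its black squares. For a square $Q=[x,x+q]\times[y,y+q]\subseteq[0,1]^2$ let $P_Q(z_x,z_y)=(qz_x+x,\,qz_y+y)$. Given a sequence of patterns $\mathcal{A}_k\subseteq\mathcal{S}_{m_k}$, $k\ge1$, put $m(n)=\prod_{k=1}^n m_k$, $\mathcal{W}_1=\mathcal{A}_1$ and, for $n\ge2$, $\mathcal{W}_n=\{P_{W'}(W)\mid W\in\mathcal{A}_n,\ W'\in\mathcal{W}_{n-1}\}\subset\mathcal{S}_{m(n)}$ (the white squares of level $n$). Let $L_n=\bigcup_{W\in\mathcal{W}_n}W$. The limit set defined by the sequence is $L_\infty=\bigcap_{n\ge1}L_n$. The graph $\mathcal{G}(\mathcal{A})$ of an $m$-pattern $\mathcal{A}$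 has the white squares as vertices, and its edges are the unordered pairs of white squares having a common side. The top row of $\mathcal{A}$ is the set of white squares in $\{S_{i,m-1,m}\mid 0\le i\le m-1\}$; bottom row, left column and right column are defined analogously. A top exit in $\mathcal{A}$ is a white square in the top row such that there is a white square in the same column in the bottom row; a bottom exit is defined analogously. A left exit is a white square in the left column such that there is a white square in the same row in the right column; a right exit is defined analogously. An $m$-pattern $\mathcal{A}$ with $m\ge3$ is a labyrinth pattern if: (1) $\mathcal{G}(\mathcal{A})$ is a tree; (2) there is exactly one top exit, exactly one bottom exit, exactly one left exit and exactly one right exit in $\mathcal{A}$; (3) if there is a white square at a corner of $\mathcal{A}$, then there is no white square at the diagonally opposite corner. When all $\mathcal{A}_k$ are labyrinth patterns, $L_\infty$ is called a mixed labyrinth fractal; it is known to be a dendrite, so any two distinct points of $L_\infty$ are connected by a unique arc in $L_\infty$. A labyrinth pattern is horizontally blocked if the row of squares from the left to the right exit contains at least one black square, and vertically blocked if the column of squares from the top to the bottom exit contains at least one black square. *)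

theory Defs
  imports "HOL-Analysis.Analysis"
begin

section \<open>Squares and patterns\<close>

type_synonym point = "real \<times> real"
type_synonym sq = "point set"

definition square_at :: "real \<Rightarrow> real \<Rightarrow> real \<Rightarrow> sq" where
  "square_at x y q = {x..x + q} \<times> {y..y + q}"

definition grid_square :: "nat \<Rightarrow> nat \<Rightarrow> nat \<Rightarrow> sq" where
  "grid_square i j m =
     {(x, y). real i / real m \<le> x \<and> x \<le> (real i + 1) / real m \<and>
              real j / real m \<le> y \<and> y \<le> (real j + 1) / real m}"

definition grid_squares :: "nat \<Rightarrow> sq set" where
  "grid_squares m = {grid_square i j m | i j. i < m \<and> j < m}"

definition pattern :: "nat \<Rightarrow> sq set \<Rightarrow> bool" where
  "pattern m A \<longleftrightarrow> 1 \<le> m \<and> A \<noteq> {} \<and> A \<subseteq> grid_squares m"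


section \<open>The graph of a pattern\<close>

definition sides :: "sq \<Rightarrow> point set set" where
  "sides Q = {s. \<exists>x y q. q > 0 \<and> Q = square_at x y q \<and>
     s \<in> {{x} \<times> {y..y + q}, {x + q} \<times> {y..y + q},
          {x..x + q} \<times> {y}, {x..x + q} \<times> {y + q}}}"

definition pattern_edges :: "sq set \<Rightarrow> sq set set" where
  "pattern_edges A = {{P, Q} | P Q. P \<in> A \<and> Q \<in> A \<and> P \<noteq> Q \<and> sides P \<inter> sides Q \<noteq> {}}"

definition graph_connected :: "'a set \<Rightarrow> 'a set set \<Rightarrow> bool" where
  "graph_connected V E \<longleftrightarrow> (\<forall>u\<in>V. \<forall>v\<in>V. (u, v) \<in> {(a, b). {a, b} \<in> E}\<^sup>*)"

text \<open>The closing edge of the cycle joins the last vertex of the list to the first.\<close>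

definition graph_cycle :: "'a set set \<Rightarrow> 'a list \<Rightarrow> bool" where
  "graph_cycle E vs \<longleftrightarrow> 3 \<le> length vs \<and> distinct vs \<and>
     (\<forall>i < length vs. {vs ! i, vs ! (Suc i mod length vs)} \<in> E)"

definition is_tree :: "'a set \<Rightarrow> 'a set set \<Rightarrow> bool" where
  "is_tree V E \<longleftrightarrow> V \<noteq> {} \<and> graph_connected V E \<and> (\<nexists>vs. graph_cycle E vs)"


section \<open>Labyrinth patterns\<close>

text \<open>
  In \<open>grid_square i j m\<close> the index \<open>i\<close> is the column, counted from the left, and \<open>j\<close> is
  the row, counted from the bottom.
\<close>

definition top_exit :: "nat \<Rightarrow> sq set \<Rightarrow> sq \<Rightarrow> bool" where
  "top_exit m A Q \<longleftrightarrow> (\<exists>i<m. Q = grid_square i (m - 1) m \<and> Q \<in> A \<and> grid_square i 0 m \<in> A)"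

definition bottom_exit :: "nat \<Rightarrow> sq set \<Rightarrow> sq \<Rightarrow> bool" where
  "bottom_exit m A Q \<longleftrightarrow> (\<exists>i<m. Q = grid_square i 0 m \<and> Q \<in> A \<and> grid_square i (m - 1) m \<in> A)"

definition left_exit :: "nat \<Rightarrow> sq set \<Rightarrow> sq \<Rightarrow> bool" where
  "left_exit m A Q \<longleftrightarrow> (\<exists>j<m. Q = grid_square 0 j m \<and> Q \<in> A \<and> grid_square (m - 1) j m \<in> A)"

definition right_exit :: "nat \<Rightarrow> sq set \<Rightarrow> sq \<Rightarrow> bool" where
  "right_exit m A Q \<longleftrightarrow> (\<exists>j<m. Q = grid_square (m - 1) j m \<and> Q \<in> A \<and> grid_square 0 j m \<in> A)"

definition labyrinth_pattern :: "nat \<Rightarrow> sq set \<Rightarrow> bool" where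
  "labyrinth_pattern m A \<longleftrightarrow>
     pattern m A \<and> 3 \<le> m \<and>
     is_tree A (pattern_edges A) \<and>
     (\<exists>!Q. top_exit m A Q) \<and> (\<exists>!Q. bottom_exit m A Q) \<and>
     (\<exists>!Q. left_exit m A Q) \<and> (\<exists>!Q. right_exit m A Q) \<and>
     \<not> (grid_square 0 0 m \<in> A \<and> grid_square (m - 1) (m - 1) m \<in> A) \<and>
     \<not> (grid_square 0 (m - 1) m \<in> A \<and> grid_square (m - 1) 0 m \<in> A)"

definition horizontally_blocked :: "nat \<Rightarrow> sq set \<Rightarrow> bool" where
  "horizontally_blocked m A \<longleftrightarrow>
     (\<exists>j<m. left_exit m A (grid_square 0 j m) \<and> (\<exists>i<m. grid_square i j m \<notin> A))"

definition vertically_blocked :: "nat \<Rightarrow> sq set \<Rightarrow> bool" where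
  "vertically_blocked m A \<longleftrightarrow>
     (\<exists>i<m. top_exit m A (grid_square i (m - 1) m) \<and> (\<exists>j<m. grid_square i j m \<notin> A))"


section \<open>The limit set\<close>

definition sq_map :: "real \<Rightarrow> real \<Rightarrow> real \<Rightarrow> point \<Rightarrow> point" where
  "sq_map x y q = (\<lambda>(zx, zy). (q * zx + x, q * zy + y))"

text \<open>
  Sequences of patterns are indexed from \<open>0\<close>, so \<open>white_squares A n\<close> is the set of white
  squares of level \<open>n + 1\<close>.
\<close>

primrec white_squares :: "(nat \<Rightarrow> sq set) \<Rightarrow> nat \<Rightarrow> sq set" where
  "white_squares A 0 = A 0"
| "white_squares A (Suc n) =
     {sq_map x y q ` W | x y q W.
        q > 0 \<and> square_at x y q \<in> white_squares A n \<and> W \<in> A (Suc n)}"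

definition limit_set :: "(nat \<Rightarrow> sq set) \<Rightarrow> point set" where
  "limit_set A = (\<Inter>n. \<Union> (white_squares A n))"


section \<open>Length of a curve\<close>

text \<open>The supremum of the lengths of inscribed polygons, with respect to the Euclidean metric.\<close>

definition curve_length :: "(real \<Rightarrow> 'a::metric_space) \<Rightarrow> ereal" where
  "curve_length g =
     (SUP (n, t) \<in> {(n :: nat, t :: nat \<Rightarrow> real).
                      (\<forall>i\<le>n. t i \<in> {0..1}) \<and> (\<forall>i<n. t i \<le> t (Suc i))}.
        ereal (\<Sum>i<n. dist (g (t i)) (g (t (Suc i)))))"

text \<open>For injective \<open>g\<close> the length depends only on the arc \<open>path_image g\<close>.\<close>

definition arc_between :: "point set \<Rightarrow> point \<Rightarrow> point \<Rightarrow> (real \<Rightarrow> point) \<Rightarrow> bool" where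
  "arc_between L p q g \<longleftrightarrow> arc g \<and> path_image g \<subseteq> L \<and> pathstart g = p \<and> pathfinish g = q"

end

theory Submission
  imports Defs
begin

text \<open>
  All patterns of the sequence can be equal.  The pattern used here is a windmill of width 7: a
  central white square, the hub, from which four arms of four squares each lead to the exits.
  Every arm makes a detour, which blocks the row and the column of the exits, and the detour is
  long enough that the path between two exits has 9 squares.  A curve that runs from exit to exit
  must cross 9 squares of the next level, each \<open>1/7\<close> as wide, so its length should be at least
  \<open>9/7\<close> of itself.

  To turn this into a proof for an arbitrary path \<open>g\<close>, without following the path from square to
  square, the limit set \<open>L\<close> is pulled straight.  For each level \<open>k\<close> there is a map \<open>\<Phi>\<close> from \<open>L\<close> to
  the plane that stays within \<open>3 / 7 ^ k\<close> of the identity and is flat: on short distances,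
  \<open>dist (\<Phi> x) (\<Phi> y)\<close> is at most an arbitrarily small multiple of \<open>dist x y\<close>
  (\<open>flat_approximation_of_identity\<close>).  If \<open>g\<close> has finite length, summing this over a fine partition
  shows that \<open>\<Phi>\<close> takes the same value at both ends of \<open>g\<close>
  (\<open>flat_map_constant_on_rectifiable_path\<close>); letting \<open>k\<close> grow, the two ends coincide.  So no arc in
  \<open>L\<close> has finite length.

  The map \<open>\<Phi>\<close> comes from interpolation.  Give each white square of level \<open>k\<close> its true centre
  and its true side midpoints as values.  On the next level the value at the hub is that of the
  centre, and along each arm the values move linearly from there to the value of the exit.  Centre
  and exit of a square differ by four squares of its arm, that is by eight half squares, so the
  distance between the values of centre and exits shrinks by the factor \<open>1/8\<close> per level, while the
  squares shrink by \<open>1/7\<close> only.  Two points of \<open>L\<close> that are close on the scale of level \<open>n + 1\<close> lie in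
  white squares of level \<open>n\<close> that are equal or share a side: the pattern has no white corner, so
  squares that touch in a corner are kept apart.  This makes the values converge and gives the
  flatness, because \<open>1/8 < 1/7\<close>.

  Arcs exist because \<open>L\<close> is path-connected.  Any two points in the same square of level \<open>n\<close> are
  linked by a chain of nine pairs of points, each pair in a common square of level \<open>n + 1\<close>, through
  the hub; refining such chains for ever defines a path (\<open>path_by_refinement\<close>), and every path
  contains an arc.
\<close>

section \<open>A windmill of four bent arms\<close>

datatype dir = Centre | East | North | West | South

text \<open>
  Each entry lists the position of a white square (column, row), the arm it lies on, its distance
  from the hub, and the directions of the previous and of the next square on its arm.  At the hub
  all directions are \<open>Centre\<close>.  The white squares are those marked in this picture:
  
    \<^item> row 6: \<open>. . # . . . .\<close>
    \<^item> row 5: \<open>. . # # . . .\<close>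
    \<^item> row 4: \<open>. . . # . . .\<close>
    \<^item> row 3: \<open>. # # # # # .\<close>
    \<^item> row 2: \<open># # . # . # #\<close>
    \<^item> row 1: \<open>. . # # . . .\<close>
    \<^item> row 0: \<open>. . # . . . .\<close>
\<close>

definition plan :: "((nat \<times> nat) \<times> dir \<times> nat \<times> dir \<times> dir) list" where
  "plan =
    [((3,3), Centre, 0, Centre, Centre),
     ((4,3), East, 1, West, East), ((5,3), East, 2, West, South),
     ((5,2), East, 3, North, East), ((6,2), East, 4, West, East),
     ((3,4), North, 1, South, North), ((3,5), North, 2, South, West),
     ((2,5), North, 3, East, North), ((2,6), North, 4, South, North),
     ((2,3), West, 1, East, West), ((1,3), West, 2, East, South),
     ((1,2), West, 3, North, West), ((0,2), West, 4, East, West),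
     ((3,2), South, 1, North, South), ((3,1), South, 2, North, West),
     ((2,1), South, 3, East, South), ((2,0), South, 4, North, South)]"

definition marked :: "nat \<Rightarrow> nat \<Rightarrow> bool" where
  "marked a b \<longleftrightarrow> (a, b) \<in> set (map fst plan)"

definition arm :: "nat \<Rightarrow> nat \<Rightarrow> dir" where
  "arm a b = fst (the (map_of plan (a, b)))"

definition depth :: "nat \<Rightarrow> nat \<Rightarrow> nat" where
  "depth a b = fst (snd (the (map_of plan (a, b))))"

definition inward :: "nat \<Rightarrow> nat \<Rightarrow> dir" where
  "inward a b = fst (snd (snd (the (map_of plan (a, b)))))"

definition outward :: "nat \<Rightarrow> nat \<Rightarrow> dir" where
  "outward a b = snd (snd (snd (the (map_of plan (a, b)))))"

fun neighbours :: "nat \<times> nat \<Rightarrow> nat \<times> nat \<Rightarrow> bool" where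
  "neighbours (a, b) (a', b') \<longleftrightarrow>
     (b = b' \<and> (a' = Suc a \<or> a = Suc a')) \<or> (a = a' \<and> (b' = Suc b \<or> b = Suc b'))"

text \<open>
  Reduces a claim about all white squares to a ground statement about a list of 17 entries, which
  rewriting can evaluate.
\<close>

lemma marked_all:
  assumes "\<forall>s\<in>set (map fst plan). P (fst s) (snd s)" "marked a b"
  shows "P a b"
  using assms by (auto simp: marked_def)

lemma marked_less: "marked a b \<Longrightarrow> a < 7 \<and> b < 7"
  by (erule marked_all[rotated]) code_simp

lemma depth_le: "marked a b \<Longrightarrow> depth a b \<le> 4"
  by (erule marked_all[rotated]) code_simp

lemma marked_left: "marked 0 b \<longleftrightarrow> b = 2"
  and marked_right: "marked 6 b \<longleftrightarrow> b = 2"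
  and marked_bottom: "marked a 0 \<longleftrightarrow> a = 2"
  and marked_top: "marked a 6 \<longleftrightarrow> a = 2"
  by (simp_all add: marked_def plan_def) 

lemma plan_hub: "marked a b \<Longrightarrow> depth a b = 0 \<Longrightarrow> a = 3 \<and> b = 3"
proof -
  have "marked a b \<Longrightarrow> depth a b = 0 \<longrightarrow> a = 3 \<and> b = 3"
    by (erule marked_all[rotated]) code_simp
  then show "marked a b \<Longrightarrow> depth a b = 0 \<Longrightarrow> a = 3 \<and> b = 3" by blast
qed

lemma plan_parent:
  assumes "marked a b" "depth a b \<noteq> 0"
  shows "\<exists>a' b'. marked a' b' \<and> neighbours (a, b) (a', b') \<and> depth a' b' < depth a b"
proof -
  have "marked a b \<Longrightarrow> depth a b \<noteq> 0 \<longrightarrow>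
    (\<exists>s\<in>set (map fst plan). neighbours (a, b) s \<and> depth (fst s) (snd s) < depth a b)"
    by (erule marked_all[rotated]) code_simp
  with assms show ?thesis unfolding marked_def by fastforce
qed

text \<open>
  Walking towards the hub is deterministic, and no two neighbours have the same depth.  This is what
  excludes cycles.
\<close>

lemma plan_parent_unique:
  assumes "marked a b" "marked a1 b1" "marked a2 b2"
    and "neighbours (a, b) (a1, b1)" "neighbours (a, b) (a2, b2)"
    and "depth a1 b1 \<le> depth a b" "depth a2 b2 \<le> depth a b"
  shows "(a1, b1) = (a2, b2)"
proof -
  have "marked a b \<Longrightarrow> \<forall>s\<in>set (map fst plan). \<forall>t\<in>set (map fst plan).
     neighbours (a, b) s \<longrightarrow> neighbours (a, b) t \<longrightarrow> depth (fst s) (snd s) \<le> depth a b \<longrightarrow>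
      depth (fst t) (snd t) \<le> depth a b \<longrightarrow> s = t"
    by (erule marked_all[rotated]) code_simp
  with assms show ?thesis unfolding marked_def by fastforce
qed

section \<open>The windmill is a blocked labyrinth pattern\<close>

lemma square_at_eq_iff:
  assumes "q > 0" "q' > 0"
  shows "square_at x y q = square_at x' y' q' \<longleftrightarrow> x = x' \<and> y = y' \<and> q = q'"
  using assms by (auto simp: square_at_def times_eq_iff Icc_eq_Icc)

lemma grid_square_eq_square_at:
  "grid_square i j m = square_at (real i / real m) (real j / real m) (1 / real m)"
  by (auto simp: grid_square_def square_at_def add_divide_distrib)

lemma grid_square_eq_iff:
  "m > 0 \<Longrightarrow> grid_square i j m = grid_square i' j' m \<longleftrightarrow> i = i' \<and> j = j'"
  by (simp add: grid_square_eq_square_at square_at_eq_iff)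

lemma mem_grid_square:
  "m > 0 \<Longrightarrow> p \<in> grid_square i j m \<longleftrightarrow>
    real i \<le> real m * fst p \<and> real m * fst p \<le> real i + 1 \<and>
    real j \<le> real m * snd p \<and> real m * snd p \<le> real j + 1"
  by (cases p) (simp add: grid_square_def field_simps)

text \<open>
  Two distinct points suffice to tell a common side from a common corner, so the sides themselves
  need not be compared.
\<close>

lemma side_has_two_points:
  assumes "s \<in> sides Q"
  shows "s \<subseteq> Q \<and> (\<exists>p\<in>s. \<exists>p'\<in>s. p \<noteq> p')"
proof -
  obtain x y q where q: "q > 0" and Q: "Q = square_at x y q" and
    s: "s \<in> {{x} \<times> {y..y + q}, {x + q} \<times> {y..y + q}, {x..x + q} \<times> {y}, {x..x + q} \<times> {y + q}}"
    using assms unfolding sides_def by blast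
  from q s have "s \<subseteq> Q" unfolding Q square_at_def by auto
  moreover from q s have "((x, y) \<in> s \<and> (x, y + q) \<in> s) \<or> ((x + q, y) \<in> s \<and> (x + q, y + q) \<in> s)
     \<or> ((x, y) \<in> s \<and> (x + q, y) \<in> s) \<or> ((x, y + q) \<in> s \<and> (x + q, y + q) \<in> s)"
    by auto
  then have "\<exists>p\<in>s. \<exists>p'\<in>s. p \<noteq> p'"
    using q by (metis add_cancel_left_right less_irrefl prod.inject)
  ultimately show ?thesis by blast
qed

lemma unit_intervals_overlap:
  fixes i i' :: nat and x :: real
  assumes "real i \<le> x" "x \<le> real i + 1" "real i' \<le> x" "x \<le> real i' + 1"
  shows "i = i' \<or> (i' = Suc i \<and> x = real i + 1) \<or> (i = Suc i' \<and> x = real i' + 1)"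
proof -
  have "i \<le> Suc i'" "i' \<le> Suc i" using assms by linarith+
  then consider "i = i'" | "i' = Suc i" | "i = Suc i'" by linarith
  then show ?thesis using assms by cases auto
qed

lemma common_side_imp_neighbours:
  assumes "m > 0" and "grid_square i j m \<noteq> grid_square i' j' m"
    and "sides (grid_square i j m) \<inter> sides (grid_square i' j' m) \<noteq> {}"
  shows "neighbours (i, j) (i', j')"
proof -
  from assms(3) obtain s where s: "s \<in> sides (grid_square i j m)" "s \<in> sides (grid_square i' j' m)"
    by auto
  obtain p p' where "p \<noteq> p'" "p \<in> s" "p' \<in> s"
    using side_has_two_points[OF s(1)] by auto
  then have pp: "p \<noteq> p'" "p \<in> grid_square i j m" "p \<in> grid_square i' j' m"
      "p' \<in> grid_square i j m" "p' \<in> grid_square i' j' m"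
    using side_has_two_points[OF s(1)] side_has_two_points[OF s(2)] by auto
  have h: "i = i' \<or> (i' = Suc i \<and> real m * z = real i + 1) \<or> (i = Suc i' \<and> real m * z = real i' + 1)"
      if "z = fst p \<or> z = fst p'" for z
    using that pp assms(1) by (intro unit_intervals_overlap) (auto simp: mem_grid_square)
  have v: "j = j' \<or> (j' = Suc j \<and> real m * z = real j + 1) \<or> (j = Suc j' \<and> real m * z = real j' + 1)"
      if "z = snd p \<or> z = snd p'" for z
    using that pp assms(1) by (intro unit_intervals_overlap) (auto simp: mem_grid_square)
  from pp(1) have "real m * fst p \<noteq> real m * fst p' \<or> real m * snd p \<noteq> real m * snd p'"
    using assms(1) by (simp add: prod_eq_iff)
  moreover have "i = i'" if "real m * fst p \<noteq> real m * fst p'"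
    using h[of "fst p"] h[of "fst p'"] that by linarith
  moreover have "j = j'" if "real m * snd p \<noteq> real m * snd p'"
    using v[of "snd p"] v[of "snd p'"] that by linarith
  moreover have "\<not> (i = i' \<and> j = j')" using assms(2) by auto
  ultimately show ?thesis
    using h[of "fst p"] v[of "snd p"] by auto
qed

lemma neighbours_imp_common_side:
  assumes "m > 0" and "neighbours (i, j) (i', j')"
  shows "sides (grid_square i j m) \<inter> sides (grid_square i' j' m) \<noteq> {}"
proof -
  define l where "l i = real i / real m" for i
  define q where "q = 1 / real m"
  have q: "q > 0" and l: "l (Suc i) = l i + q" for i
    using assms(1) by (simp_all add: q_def l_def add_divide_distrib)
  have sq: "grid_square i j m = square_at (l i) (l j) q" for i j
    by (simp add: grid_square_eq_square_at q_def l_def)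
  have mem: "{l i} \<times> {l j..l j + q} \<in> sides (grid_square i j m)"
       "{l i + q} \<times> {l j..l j + q} \<in> sides (grid_square i j m)"
       "{l i..l i + q} \<times> {l j} \<in> sides (grid_square i j m)"
       "{l i..l i + q} \<times> {l j + q} \<in> sides (grid_square i j m)" for i j
    unfolding sides_def sq using q by blast+
  from assms(2) consider "i' = Suc i" "j = j'" | "i = Suc i'" "j = j'"
    | "i = i'" "j' = Suc j" | "i = i'" "j = Suc j'" by auto
  then show ?thesis
  proof cases
    case 1 then show ?thesis using mem(2)[of i j] mem(1)[of i' j'] l by auto
  next
    case 2 then show ?thesis using mem(1)[of i j] mem(2)[of i' j'] l by auto
  next
    case 3 then show ?thesis using mem(4)[of i j] mem(3)[of i' j'] l by auto
  next
    case 4 then show ?thesis using mem(3)[of i j] mem(4)[of i' j'] l by auto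
  qed
qed

text \<open>
  A vertex of maximal rank on a cycle has two distinct neighbours there, both of at most its rank.
\<close>

lemma no_cycle_if_ranked:
  fixes rank :: "'a \<Rightarrow> nat"
  assumes "\<And>u v w. {u, v} \<in> E \<Longrightarrow> {u, w} \<in> E \<Longrightarrow> rank v \<le> rank u \<Longrightarrow> rank w \<le> rank u \<Longrightarrow> v = w"
  shows "\<not> graph_cycle E vs"
proof
  assume c: "graph_cycle E vs"
  define l where "l = length vs"
  have l: "3 \<le> l" and d: "distinct vs" and e: "\<And>i. i < l \<Longrightarrow> {vs ! i, vs ! (Suc i mod l)} \<in> E"
    using c by (auto simp: graph_cycle_def l_def)
  define r where "r = Max ((\<lambda>i. rank (vs ! i)) ` {..<l})"
  have "r \<in> (\<lambda>i. rank (vs ! i)) ` {..<l}" unfolding r_def using l by (intro Max_in) (auto simp: lessThan_empty_iff)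
  then obtain i where i: "i < l" "rank (vs ! i) = r" by auto
  have le: "rank (vs ! j) \<le> rank (vs ! i)" if "j < l" for j
    unfolding i(2) r_def using that by (intro Max_ge) auto
  define p where "p = (if i = 0 then l - 1 else i - 1)"
  define s where "s = Suc i mod l"
  have p: "p < l" "Suc p mod l = i" using i l by (auto simp: p_def)
  have s: "s < l" "s \<noteq> p" using i l by (auto simp: s_def p_def mod_Suc)
  have "{vs ! i, vs ! p} \<in> E" using e[OF p(1)] p(2) by (simp add: insert_commute)
  moreover have "{vs ! i, vs ! s} \<in> E" using e[OF i(1)] by (simp add: s_def)
  ultimately have "vs ! p = vs ! s" using assms le p s by blast
  then show False using d p s by (simp add: nth_eq_iff_index_eq l_def)
qed

definition windmill :: "sq set" where
  "windmill = {grid_square a b 7 | a b. marked a b}"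

lemma grid_square_in_windmill: "grid_square a b 7 \<in> windmill \<longleftrightarrow> marked a b"
  by (auto simp: windmill_def grid_square_eq_iff)

lemma windmill_edge_iff:
  "{P, Q} \<in> pattern_edges windmill \<longleftrightarrow>
    (\<exists>a b a' b'. P = grid_square a b 7 \<and> Q = grid_square a' b' 7 \<and>
       marked a b \<and> marked a' b' \<and> neighbours (a, b) (a', b'))" (is "_ \<longleftrightarrow> ?R P Q")
proof
  assume "{P, Q} \<in> pattern_edges windmill"
  then have "P \<in> windmill \<and> Q \<in> windmill \<and> P \<noteq> Q \<and> sides P \<inter> sides Q \<noteq> {}"
    unfolding pattern_edges_def by (auto simp: doubleton_eq_iff)
  moreover from this obtain a b a' b' where "P = grid_square a b 7" "Q = grid_square a' b' 7"
      "marked a b" "marked a' b'"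
    unfolding windmill_def by auto
  ultimately have "neighbours (a, b) (a', b')" using common_side_imp_neighbours[of 7 a b a' b'] by simp
  then show "?R P Q" using \<open>P = _\<close> \<open>Q = _\<close> \<open>marked a b\<close> \<open>marked a' b'\<close> by blast
next
  assume "?R P Q"
  then obtain a b a' b' where ab: "P = grid_square a b 7" "Q = grid_square a' b' 7"
       "marked a b" "marked a' b'" "neighbours (a, b) (a', b')" by blast
  then have "sides P \<inter> sides Q \<noteq> {}"
    using neighbours_imp_common_side[of 7 a b a' b'] by simp
  moreover have "P \<noteq> Q" using ab by (auto simp: grid_square_eq_iff)
  moreover have "P \<in> windmill" "Q \<in> windmill" using ab by (simp_all add: grid_square_in_windmill)
  ultimately show "{P, Q} \<in> pattern_edges windmill"
    unfolding pattern_edges_def by blast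
qed

lemma windmill_connected: "graph_connected windmill (pattern_edges windmill)"
proof -
  define E where "E = {(P, Q). {P, Q} \<in> pattern_edges windmill}"
  have to_hub: "(grid_square a b 7, grid_square 3 3 7) \<in> E\<^sup>*" if "marked a b" for a b
    using that
  proof (induction "depth a b" arbitrary: a b rule: less_induct)
    case less
    show ?case
    proof (cases "depth a b = 0")
      case True
      show ?thesis using plan_hub[OF less.prems True] by simp
    next
      case False
      then obtain a' b' where p: "marked a' b'" "neighbours (a, b) (a', b')" "depth a' b' < depth a b"
        using plan_parent[OF less.prems False] by auto
      then have "(grid_square a b 7, grid_square a' b' 7) \<in> E"
        unfolding E_def using windmill_edge_iff less.prems by blast
      then show ?thesis using less.hyps[OF p(3,1)] by (rule converse_rtrancl_into_rtrancl)
    qed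
  qed
  have "sym E" unfolding E_def sym_def by (simp add: insert_commute)
  then have "sym (E\<^sup>*)" by (rule sym_rtrancl)
  then have "(P, Q) \<in> E\<^sup>*" if "P \<in> windmill" "Q \<in> windmill" for P Q
  proof -
    have "(P, grid_square 3 3 7) \<in> E\<^sup>*" "(Q, grid_square 3 3 7) \<in> E\<^sup>*"
      using that to_hub unfolding windmill_def by auto
    then show ?thesis using \<open>sym (E\<^sup>*)\<close> by (meson rtrancl_trans symD)
  qed
  then show ?thesis unfolding graph_connected_def E_def by simp
qed

lemma windmill_acyclic: "\<not> graph_cycle (pattern_edges windmill) vs"
proof (rule no_cycle_if_ranked)
  define rank where "rank Q = depth (fst (inv_into UNIV (\<lambda>(a, b). grid_square a b 7) Q)) 
     (snd (inv_into UNIV (\<lambda>(a, b). grid_square a b 7) Q))" for Q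
  have "inj (\<lambda>(a, b). grid_square a b 7)" by (auto simp: inj_def grid_square_eq_iff)
  then have r: "rank (grid_square a b 7) = depth a b" for a b
    unfolding rank_def using inv_f_f[of "\<lambda>(a, b). grid_square a b 7" "(a, b)"] by simp
  fix u v w
  assume "{u, v} \<in> pattern_edges windmill" "{u, w} \<in> pattern_edges windmill"
    and le: "rank v \<le> rank u" "rank w \<le> rank u"
  then obtain a b a1 b1 a' b' a2 b2 where
      u: "u = grid_square a b 7" and v: "v = grid_square a1 b1 7" and
      u': "u = grid_square a' b' 7" and w: "w = grid_square a2 b2 7" and
      ma: "marked a b" "marked a1 b1" "marked a2 b2" and
      nb: "neighbours (a, b) (a1, b1)" "neighbours (a', b') (a2, b2)"
    unfolding windmill_edge_iff by blast
  have "a' = a" "b' = b" using u u' by (auto simp: grid_square_eq_iff)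
  then show "v = w"
    using plan_parent_unique[OF ma nb(1)] nb(2) le r unfolding u v w by auto
qed

text \<open>
  On the boundary of the unit square only the four exits are white: each side meets the pattern in
  one square, which gives the uniqueness of the exits, and no corner is white.  The square in
  column 2 and row 2, where the lines through the exits cross, is black.
\<close>

lemma windmill_labyrinth:
  "labyrinth_pattern 7 windmill"
  "horizontally_blocked 7 windmill"
  "vertically_blocked 7 windmill"
proof -
  note m = marked_left marked_right marked_top marked_bottom grid_square_in_windmill
  have hub: "marked 3 3" and gap: "\<not> marked 2 2" by (simp_all add: marked_def plan_def)
  have p: "pattern 7 windmill"
    unfolding pattern_def grid_squares_def using hub marked_less by (auto simp: windmill_def)
  have ex: "top_exit 7 windmill Q \<longleftrightarrow> Q = grid_square 2 6 7"
     "bottom_exit 7 windmill Q \<longleftrightarrow> Q = grid_square 2 0 7"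
     "left_exit 7 windmill Q \<longleftrightarrow> Q = grid_square 0 2 7"
     "right_exit 7 windmill Q \<longleftrightarrow> Q = grid_square 6 2 7" for Q
    by (auto simp: top_exit_def bottom_exit_def left_exit_def right_exit_def m)
  show "labyrinth_pattern 7 windmill"
    unfolding labyrinth_pattern_def is_tree_def
    using p windmill_connected windmill_acyclic by (auto simp: ex m pattern_def)
  show "horizontally_blocked 7 windmill"
    unfolding horizontally_blocked_def using gap
    by (intro exI[of _ 2]) (auto simp: ex m intro: exI[of _ 2])
  show "vertically_blocked 7 windmill"
    unfolding vertically_blocked_def using gap
    by (intro exI[of _ 2]) (auto simp: ex m intro: exI[of _ 2])
qed

section \<open>The limit set in integer coordinates\<close>

definition cell :: "nat \<Rightarrow> nat \<Rightarrow> nat \<Rightarrow> sq" where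
  "cell n i j = grid_square i j (7 ^ n)"

text \<open>
  The digits of \<open>i\<close> and \<open>j\<close> in base 7, read from the most significant one, are the positions of the
  successive patterns in which the square was chosen.  Level 0 is the unit square, so the squares of
  level \<open>n\<close> here are \<open>white_squares\<close> of index \<open>n - 1\<close>.
\<close>

primrec white :: "nat \<Rightarrow> nat \<Rightarrow> nat \<Rightarrow> bool" where
  "white 0 i j \<longleftrightarrow> i = 0 \<and> j = 0"
| "white (Suc n) i j \<longleftrightarrow> white n (i div 7) (j div 7) \<and> marked (i mod 7) (j mod 7)"

abbreviation fractal :: "point set" where
  "fractal \<equiv> limit_set (\<lambda>_. windmill)"

lemma mem_cell:
  "p \<in> cell n i j \<longleftrightarrow>
    real i \<le> 7 ^ n * fst p \<and> 7 ^ n * fst p \<le> real i + 1 \<and>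
    real j \<le> 7 ^ n * snd p \<and> 7 ^ n * snd p \<le> real j + 1"
  by (simp add: cell_def mem_grid_square)

lemma cell_parent:
  assumes "p \<in> cell (Suc n) i j"
  shows "p \<in> cell n (i div 7) (j div 7)"
proof -
  have "7 * (i div 7) \<le> i \<and> i + 1 \<le> 7 * (i div 7) + 7" for i :: nat by linarith
  then have "7 * real (i div 7) \<le> real i \<and> real i + 1 \<le> 7 * real (i div 7) + 7" for i
    by (metis (mono_tags) of_nat_1 of_nat_add of_nat_le_iff of_nat_mult of_nat_numeral)
  from this[of i] this[of j] assms show ?thesis
    unfolding mem_cell by (simp add: mult.assoc)
qed

lemma white_child:
  "white n i j \<Longrightarrow> marked a b \<Longrightarrow> white (Suc n) (7 * i + a) (7 * j + b)"
  using marked_less[of a b] by simp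

lemma white_less: "white n i j \<Longrightarrow> i < 7 ^ n \<and> j < 7 ^ n"
proof (induction n arbitrary: i j)
  case (Suc n)
  then have "i div 7 < 7 ^ n" "j div 7 < 7 ^ n" by auto
  then show ?case by (simp add: div_less_iff_less_mult mult.commute)
qed simp

lemma sq_map_image_square_at:
  assumes "q > 0"
  shows "sq_map x y q ` square_at u v r = square_at (q * u + x) (q * v + y) (q * r)"
proof -
  have "sq_map x y q ` (S \<times> T) = (\<lambda>z. q * z + x) ` S \<times> (\<lambda>z. q * z + y) ` T" for S T
    by (force simp: sq_map_def)
  moreover have "(\<lambda>z. q * z + c) ` {w..w + r} = {q * w + c..q * w + c + q * r}" for w c
    by (subst image_affinity_atLeastAtMost)
      (use assms in \<open>auto simp: algebra_simps mult_less_0_iff zero_le_mult_iff\<close>)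
  ultimately show ?thesis by (simp add: square_at_def)
qed

lemma sq_map_image_grid_square:
  assumes "q > 0" "square_at x y q = cell n i j"
  shows "sq_map x y q ` grid_square a b 7 = cell (Suc n) (7 * i + a) (7 * j + b)"
proof -
  have "square_at x y q = square_at (i / 7 ^ n) (j / 7 ^ n) (1 / 7 ^ n)"
    using assms(2) by (simp add: cell_def grid_square_eq_square_at)
  then have "x = i / 7 ^ n" "y = j / 7 ^ n" "q = 1 / 7 ^ n"
    using assms(1) by (simp_all add: square_at_eq_iff)
  then show ?thesis
    using assms(1)
    by (simp add: cell_def grid_square_eq_square_at sq_map_image_square_at add_divide_distrib ac_simps)
qed

lemma white_squares_windmill:
  "white_squares (\<lambda>_. windmill) n = {cell (Suc n) i j | i j. white (Suc n) i j}"
proof (induction n)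
  case 0
  have "white (Suc 0) i j \<longleftrightarrow> marked i j" for i j
    using marked_less[of i j] by (auto simp: div_eq_0_iff)
  then show ?case by (simp add: windmill_def cell_def)
next
  case (Suc n)
  show ?case (is "?L = ?R")
  proof
    show "?L \<subseteq> ?R"
    proof
      fix S assume "S \<in> ?L"
      then obtain x y q W where S: "S = sq_map x y q ` W" "q > 0"
          "square_at x y q \<in> white_squares (\<lambda>_. windmill) n" "W \<in> windmill"
        by auto
      from S(3) obtain i j where ij: "square_at x y q = cell (Suc n) i j" "white (Suc n) i j"
        unfolding Suc by blast
      from S(4) obtain a b where ab: "W = grid_square a b 7" "marked a b"
        unfolding windmill_def by blast
      from ij ab have "S = cell (Suc (Suc n)) (7 * i + a) (7 * j + b)"
        using S sq_map_image_grid_square by simp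
      then show "S \<in> ?R" using white_child[OF ij(2) ab(2)] by blast
    qed
    show "?R \<subseteq> ?L"
    proof
      fix S assume "S \<in> ?R"
      then obtain i j where S: "S = cell (Suc (Suc n)) i j" and w: "white (Suc (Suc n)) i j" by blast
      define q :: real where "q = 1 / 7 ^ Suc n"
      define x where "x = real (i div 7) / 7 ^ Suc n"
      define y where "y = real (j div 7) / 7 ^ Suc n"
      have q: "q > 0" and sq: "square_at x y q = cell (Suc n) (i div 7) (j div 7)"
        by (simp_all add: q_def x_def y_def cell_def grid_square_eq_square_at)
      have "S = sq_map x y q ` grid_square (i mod 7) (j mod 7) 7"
        unfolding S sq_map_image_grid_square[OF q sq] by simp
      moreover have "square_at x y q \<in> white_squares (\<lambda>_. windmill) n"
        unfolding Suc sq using w by auto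
      moreover have "grid_square (i mod 7) (j mod 7) 7 \<in> windmill"
        using w by (simp add: grid_square_in_windmill)
      ultimately show "S \<in> ?L" using q by auto
    qed
  qed
qed

lemma mem_fractal: "p \<in> fractal \<longleftrightarrow> (\<forall>n. \<exists>i j. white n i j \<and> p \<in> cell n i j)"
proof -
  have "p \<in> fractal \<longleftrightarrow> (\<forall>n. \<exists>i j. white (Suc n) i j \<and> p \<in> cell (Suc n) i j)"
    unfolding limit_set_def white_squares_windmill by blast
  also have "\<dots> \<longleftrightarrow> (\<forall>n. \<exists>i j. white n i j \<and> p \<in> cell n i j)"
  proof (intro iffI allI)
    fix n assume "\<forall>n. \<exists>i j. white (Suc n) i j \<and> p \<in> cell (Suc n) i j"
    then obtain i j where "white (Suc n) i j" "p \<in> cell (Suc n) i j" by blast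
    then show "\<exists>i j. white n i j \<and> p \<in> cell n i j" using cell_parent[of p n i j] by (intro exI[of _ "i div 7"] exI[of _ "j div 7"]) auto
  qed blast
  finally show ?thesis .
qed

lemma closed_fractal: "closed fractal"
proof -
  have "closed (grid_square i j m)" for i j m
    unfolding grid_square_eq_square_at square_at_def by (intro closed_Times) auto
  moreover have "finite (white_squares (\<lambda>_. windmill) n)" for n
  proof (rule finite_subset)
    show "white_squares (\<lambda>_. windmill) n \<subseteq> (\<lambda>(i, j). cell (Suc n) i j) ` ({..<7 ^ Suc n} \<times> {..<7 ^ Suc n})"
      unfolding white_squares_windmill using white_less by blast
  qed simp
  ultimately show ?thesis
    unfolding limit_set_def
    by (intro closed_INT ballI closed_Union) (auto simp: white_squares_windmill cell_def)
qed

section \<open>Path-connectedness\<close>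

text \<open>
  Besides the limit, the rate of convergence is needed, both for the construction of paths and for
  that of the flat maps.
\<close>

lemma geometric_limit:
  fixes s :: "nat \<Rightarrow> 'a::complete_space"
  assumes q: "0 \<le> q" "q < 1" and step: "\<And>n. dist (s n) (s (Suc n)) \<le> B * q ^ n"
  obtains l where "s \<longlonglongrightarrow> l" "\<And>n. dist (s n) l \<le> B / (1 - q) * q ^ n"
proof -
  have B: "0 \<le> B" using order_trans[OF zero_le_dist step[of 0]] by simp
  have far: "dist (s n) (s (n + k)) \<le> B / (1 - q) * (q ^ n - q ^ (n + k))" for n k
  proof (induction k)
    case (Suc k)
    have "dist (s n) (s (n + Suc k)) \<le> dist (s n) (s (n + k)) + dist (s (n + k)) (s (Suc (n + k)))"
      using dist_triangle by simp
    also have "\<dots> \<le> B / (1 - q) * (q ^ n - q ^ (n + k)) + B * q ^ (n + k)"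
      using Suc step by (intro add_mono)
    also have "B * q ^ (n + k) = B / (1 - q) * (q ^ (n + k) - q ^ (n + Suc k))"
      using q by (simp add: field_simps)
    finally show ?case by (simp add: algebra_simps)
  qed simp
  have bound: "dist (s n) (s m) \<le> B / (1 - q) * q ^ n" if "n \<le> m" for n m
  proof -
    have "B / (1 - q) * (q ^ n - q ^ m) \<le> B / (1 - q) * q ^ n"
      using B q by (intro mult_left_mono) auto
    then show ?thesis using far[of n "m - n"] that by simp
  qed
  have lim0: "(\<lambda>n. B / (1 - q) * q ^ n) \<longlonglongrightarrow> 0"
    using q by (auto intro!: tendsto_eq_intros LIMSEQ_power_zero)
  have "Cauchy s"
  proof (rule metric_CauchyI)
    fix e :: real assume "0 < e"
    then have "0 < e / 2" by simp
    from order_tendstoD(2)[OF lim0 this] obtain M where M: "B / (1 - q) * q ^ M < e / 2"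
      by (auto simp: eventually_sequentially)
    have "dist (s m) (s n) < e" if "M \<le> m" "M \<le> n" for m n
      using bound[OF that(1)] bound[OF that(2)] M dist_triangle3[of "s m" "s n" "s M"] by linarith
    then show "\<exists>M. \<forall>m\<ge>M. \<forall>n\<ge>M. dist (s m) (s n) < e" by blast
  qed
  then obtain l where l: "s \<longlonglongrightarrow> l" using Cauchy_convergent convergent_def by blast
  have "dist (s n) l \<le> B / (1 - q) * q ^ n" for n
  proof (rule tendsto_upperbound)
    show "(\<lambda>m. dist (s n) (s m)) \<longlonglongrightarrow> dist (s n) l" by (intro tendsto_intros l)
    show "\<forall>\<^sub>F m in sequentially. dist (s n) (s m) \<le> B / (1 - q) * q ^ n"
      using bound by (auto simp: eventually_sequentially)
  qed simp
  with l show thesis by (rule that)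
qed

lemma dist_chain:
  fixes f :: "nat \<Rightarrow> 'a::metric_space"
  shows "dist (f 0) (f n) \<le> (\<Sum>i<n. dist (f i) (f (Suc i)))"
proof (induction n)
  case (Suc n)
  then show ?case using dist_triangle[of "f 0" "f (Suc n)" "f n"] by simp
qed simp

text \<open>
  Start with the pair \<open>(x, y)\<close> and replace each pair again and again by a chain of \<open>N\<close> pairs of the
  next level.  After \<open>n\<close> steps this gives points indexed by the multiples of \<open>1 / N ^ n\<close> in \<open>[0, 1]\<close>,
  with consecutive points close to each other.  The points of later steps stay close to those of
  earlier ones, so the resulting step functions converge uniformly, and the limit is continuous.
\<close>

lemma path_by_refinement:
  fixes R :: "nat \<Rightarrow> ('a::complete_space \<times> 'a) set"
  assumes K: "closed K" "\<And>n. R n \<subseteq> K \<times> K"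
    and q: "0 < q" "q < 1" and diam: "\<And>n x y. (x, y) \<in> R n \<Longrightarrow> dist x y \<le> C * q ^ n"
    and N: "0 < N" and refine: "\<And>n. R n \<subseteq> R (Suc n) ^^ N"
    and xy: "(x, y) \<in> R 0" "(y, y) \<in> R 0"
  shows "\<exists>g. path g \<and> path_image g \<subseteq> K \<and> pathstart g = x \<and> pathfinish g = y"
proof -
  define chain where "chain n u v f \<longleftrightarrow> f 0 = u \<and> f N = v \<and> (\<forall>i<N. (f i, f (Suc i)) \<in> R (Suc n))"
    for n u v and f :: "nat \<Rightarrow> 'a"
  define z where "z n u v = (SOME f. chain n u v f)" for n u v
  have z: "z n u v 0 = u \<and> z n u v N = v \<and> (\<forall>i<N. (z n u v i, z n u v (Suc i)) \<in> R (Suc n))"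
    if "(u, v) \<in> R n" for n u v
  proof -
    have "(u, v) \<in> R (Suc n) ^^ N" using refine that by auto
    then have "\<exists>f. chain n u v f" unfolding relpow_fun_conv chain_def by simp
    then have "chain n u v (z n u v)" unfolding z_def by (rule someI_ex)
    then show ?thesis unfolding chain_def .
  qed
  \<comment> \<open>The points of step n are P n 0, P n 1, ...; beyond the index N ^ n they carry on from the
      pair (y, y), so that no case distinction is needed at the end point.\<close>
  define P where "P = rec_nat (\<lambda>k::nat. if k = 0 then x else y)
     (\<lambda>n p k. z n (p (k div N)) (p (Suc (k div N))) (k mod N))"
  have P0: "P 0 k = (if k = 0 then x else y)"
    and PS: "P (Suc n) k = z n (P n (k div N)) (P n (Suc (k div N))) (k mod N)" for n k
    by (simp_all add: P_def)
  have link: "(P n k, P n (Suc k)) \<in> R n" for n k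
  proof (induction n arbitrary: k)
    case 0
    then show ?case using xy by (simp add: P0)
  next
    case (Suc n)
    define c where "c = k div N"
    note zc = z[OF Suc[of c]] and zc' = z[OF Suc[of "Suc c"]]
    show ?case
    proof (cases "Suc (k mod N) = N")
      case True
      then have "Suc k div N = Suc c" "Suc k mod N = 0"
        by (simp_all add: c_def div_Suc mod_Suc)
      then have "P (Suc n) (Suc k) = z n (P n c) (P n (Suc c)) N"
        using zc zc' by (simp add: PS)
      then show ?thesis using zc True N mod_less_divisor[of N k]
        by (metis PS c_def)
    next
      case False
      then have "Suc k div N = c" "Suc k mod N = Suc (k mod N)"
        by (simp_all add: c_def div_Suc mod_Suc)
      then show ?thesis using zc N False
        by (simp add: PS c_def[symmetric])
    qed
  qed
  define B where "B = real N * (C * q)"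
  have B0: "0 \<le> C" using order_trans[OF zero_le_dist diam[OF xy(1)]] by simp
  have down: "dist (P n (k div N)) (P (Suc n) k) \<le> B * q ^ n" for n k
  proof -
    define f where "f = z n (P n (k div N)) (P n (Suc (k div N)))"
    have f: "f 0 = P n (k div N)" "\<And>i. i < N \<Longrightarrow> (f i, f (Suc i)) \<in> R (Suc n)"
      using z[OF link] by (simp_all add: f_def)
    have kN: "k mod N < N" using N by simp
    have "dist (P n (k div N)) (P (Suc n) k) = dist (f 0) (f (k mod N))"
      by (simp add: PS f(1)) (simp add: f_def)
    also have "\<dots> \<le> (\<Sum>i<k mod N. dist (f i) (f (Suc i)))" by (rule dist_chain)
    also have "\<dots> \<le> (\<Sum>i<k mod N. C * q ^ Suc n)"
      using kN by (intro sum_mono diam f) auto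
    also have "\<dots> \<le> real N * (C * q ^ Suc n)"
      using kN B0 q by (auto intro!: mult_right_mono)
    finally show ?thesis by (simp add: B_def mult_ac)
  qed
  \<comment> \<open>The step function of step n: the point belonging to the largest multiple of 1 / N ^ n
      that does not exceed t.\<close>
  define a where "a n t = P n (nat \<lfloor>real N ^ n * t\<rfloor>)" for n and t :: real
  have fl: "nat \<lfloor>real N ^ n * t\<rfloor> = nat \<lfloor>real N ^ Suc n * t\<rfloor> div N" if "0 \<le> t" for n t
  proof -
    have "\<lfloor>real N ^ n * t\<rfloor> = \<lfloor>real N ^ Suc n * t / real_of_int (int N)\<rfloor>" using N by simp
    also have "\<dots> = \<lfloor>real N ^ Suc n * t\<rfloor> div int N" by (rule floor_divide_real_eq_div) simp
    finally show ?thesis using that by (simp add: nat_div_distrib)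
  qed
  have stepa: "dist (a n t) (a (Suc n) t) \<le> B * q ^ n" if "0 \<le> t" for n t
    unfolding a_def by (subst fl[OF that]) (rule down)
  define c where "c = B / (1 - q)"
  have "\<exists>l. (\<lambda>n. a n t) \<longlonglongrightarrow> l \<and> (\<forall>n. dist (a n t) l \<le> c * q ^ n)" if "0 \<le> t" for t
  proof -
    have "0 \<le> q" using q by simp
    from geometric_limit[of q "\<lambda>n. a n t" B, OF this q(2) stepa[OF that]]
    show ?thesis unfolding c_def by blast
  qed
  then have "\<forall>t\<in>{0..}. \<exists>l. (\<lambda>n. a n t) \<longlonglongrightarrow> l \<and> (\<forall>n. dist (a n t) l \<le> c * q ^ n)"
    by simp
  from bchoice[OF this] obtain g where g: "\<And>t. 0 \<le> t \<Longrightarrow> (\<lambda>n. a n t) \<longlonglongrightarrow> g t"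
      and gd: "\<And>t n. 0 \<le> t \<Longrightarrow> dist (a n t) (g t) \<le> c * q ^ n"
    by auto
  have inK: "P n k \<in> K" for n k using link K(2) by blast
  have gK: "g t \<in> K" if "0 \<le> t" for t
    by (rule closed_sequentially[OF K(1) _ g[OF that]]) (simp add: a_def inK)
  have "P n 0 = x" for n
  proof (induction n)
    case (Suc n)
    then show ?case using z[OF link[of n 0]] by (simp add: PS)
  qed (simp add: P0)
  then have "a n 0 = x" for n by (simp add: a_def)
  then have g0: "g 0 = x" using LIMSEQ_unique[OF g[of 0]] by simp
  have "P n (N ^ n) = y" for n
  proof (induction n)
    case (Suc n)
    then show ?case using z[OF link[of n "N ^ n"]] N by (simp add: PS)
  qed (simp add: P0)
  moreover have "nat \<lfloor>real N ^ n\<rfloor> = N ^ n" for n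
    by (metis floor_of_nat nat_int of_nat_power)
  ultimately have "a n 1 = y" for n by (simp add: a_def)
  then have g1: "g 1 = y" using LIMSEQ_unique[OF g[of 1]] by simp
  have near: "dist (a n s) (a n t) \<le> C * q ^ n" if "0 \<le> s" "s \<le> t" "t < s + 1 / real N ^ n" for n s t
  proof -
    have p: "real N ^ n > 0" using N by simp
    then have "real N ^ n * t < real N ^ n * s + 1"
      using that(3) by (simp add: field_simps)
    moreover have "real N ^ n * s \<le> real N ^ n * t" "0 \<le> real N ^ n * s" using that p by simp_all
    ultimately have "nat \<lfloor>real N ^ n * t\<rfloor> = nat \<lfloor>real N ^ n * s\<rfloor> \<or>
        nat \<lfloor>real N ^ n * t\<rfloor> = Suc (nat \<lfloor>real N ^ n * s\<rfloor>)"
      by linarith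
    moreover have "0 \<le> C * q ^ n" using B0 q by simp
    ultimately show ?thesis unfolding a_def using diam[OF link] by (metis dist_self)
  qed
  have close: "dist (g s) (g t) \<le> (2 * c + C) * q ^ n"
    if "0 \<le> s" "s \<le> t" "t < s + 1 / real N ^ n" for n s t
    using near[OF that] gd[of s n] gd[of t n] that dist_triangle[of "g s" "g t" "a n s"]
      dist_triangle[of "a n s" "g t" "a n t"]
    by (simp add: dist_commute algebra_simps)
  have "continuous_on {0..1} g"
    unfolding continuous_on_iff
  proof (intro ballI allI impI)
    fix s e :: real assume s: "s \<in> {0..1}" and e: "0 < e"
    have "(\<lambda>n. (2 * c + C) * q ^ n) \<longlonglongrightarrow> 0"
      using q by (auto intro!: tendsto_eq_intros LIMSEQ_power_zero)
    from order_tendstoD(2)[OF this e] obtain n where n: "(2 * c + C) * q ^ n < e"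
      by (auto simp: eventually_sequentially)
    have "dist (g t) (g s) < e" if "t \<in> {0..1}" "dist t s < 1 / real N ^ n" for t
      using that s n close[of s t n] close[of t s n]
      by (cases "s \<le> t") (auto simp: dist_real_def dist_commute)
    moreover have "0 < 1 / real N ^ n" using N by simp
    ultimately show "\<exists>d>0. \<forall>t\<in>{0..1}. dist t s < d \<longrightarrow> dist (g t) (g s) < e" by blast
  qed
  then show ?thesis
    using gK g0 g1 unfolding path_def path_image_def pathstart_def pathfinish_def
    by (intro exI[of _ g]) auto
qed

lemma dist_le_coordinates: "dist p p' \<le> \<bar>fst p - fst p'\<bar> + \<bar>snd p - snd p'\<bar>" for p p' :: point
  unfolding dist_prod_def dist_real_def
  using sqrt_sum_squares_le_sum_abs[of "fst p - fst p'" "snd p - snd p'"] by simp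

text \<open>
  \<open>mem_fractal\<close> provides a white square around a point on each level, but not that these squares are
  nested.  The part of the fractal that grows inside a given square is therefore described by the
  white descendants of that square.
\<close>

primrec traced :: "nat \<Rightarrow> nat \<Rightarrow> nat \<Rightarrow> nat \<Rightarrow> point \<Rightarrow> bool" where
  "traced 0 n i j p \<longleftrightarrow> p \<in> cell n i j"
| "traced (Suc N) n i j p \<longleftrightarrow> (\<exists>a b. marked a b \<and> traced N (Suc n) (7 * i + a) (7 * j + b) p)"

definition piece :: "nat \<Rightarrow> nat \<Rightarrow> nat \<Rightarrow> point set" where
  "piece n i j = {p. \<forall>N. traced N n i j p}"

lemma traced_Suc: "traced (Suc N) n i j p \<Longrightarrow> traced N n i j p"
proof (induction N arbitrary: n i j)
  case 0
  then obtain a b where "marked a b" "p \<in> cell (Suc n) (7 * i + a) (7 * j + b)" by auto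
  then show ?case using cell_parent[of p n "7 * i + a" "7 * j + b"] marked_less[of a b] by simp
next
  case (Suc N)
  then obtain a b where "marked a b" "traced (Suc N) (Suc n) (7 * i + a) (7 * j + b) p"
    by (metis traced.simps(2))
  with Suc.IH show ?case by (metis traced.simps(2))
qed

lemma traced_antimono: "N \<le> M \<Longrightarrow> traced M n i j p \<Longrightarrow> traced N n i j p"
  by (induction rule: dec_induct) (auto dest: traced_Suc simp del: traced.simps)

lemma piece_subset_cell: "piece n i j \<subseteq> cell n i j"
  unfolding piece_def by (metis (mono_tags) mem_Collect_eq subsetI traced.simps(1))

lemma piece_child_subset:
  "marked a b \<Longrightarrow> piece (Suc n) (7 * i + a) (7 * j + b) \<subseteq> piece n i j"
  unfolding piece_def by (auto intro: traced_Suc simp del: traced.simps) (metis traced.simps(2) traced_Suc)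

text \<open>
  Koenig's lemma: if the point had only finitely many generations of descendants in each child, then
  a common bound for the finitely many children would bound its generations in the parent.
\<close>

lemma piece_in_child:
  assumes "p \<in> piece n i j"
  shows "\<exists>a b. marked a b \<and> p \<in> piece (Suc n) (7 * i + a) (7 * j + b)"
proof (rule ccontr)
  define T where "T = {(a, b). marked a b}"
  have T: "finite T"
    by (rule finite_subset[of _ "{..<7} \<times> {..<7}"]) (auto simp: T_def dest: marked_less)
  assume "\<not> ?thesis"
  then have "\<forall>s\<in>T. \<exists>N. \<not> traced N (Suc n) (7 * i + fst s) (7 * j + snd s) p"
    by (auto simp: T_def piece_def)
  then obtain f where f: "\<And>s. s \<in> T \<Longrightarrow> \<not> traced (f s) (Suc n) (7 * i + fst s) (7 * j + snd s) p"
    by metis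
  have "traced (Suc (Max (f ` T))) n i j p" using assms by (simp add: piece_def del: traced.simps)
  then obtain a b where ab: "marked a b" "traced (Max (f ` T)) (Suc n) (7 * i + a) (7 * j + b) p"
    by auto
  then have "(a, b) \<in> T" by (simp add: T_def)
  then have "f (a, b) \<le> Max (f ` T)" using T by simp
  then show False using traced_antimono[OF _ ab(2)] f[OF \<open>(a, b) \<in> T\<close>] by simp
qed

lemma piece_subset_fractal:
  assumes "white n i j"
  shows "piece n i j \<subseteq> fractal"
proof -
  have "piece n i j \<subseteq> piece 0 0 0"
    using assms
  proof (induction n arbitrary: i j)
    case (Suc n)
    then have "piece n (i div 7) (j div 7) \<subseteq> piece 0 0 0" "marked (i mod 7) (j mod 7)" by auto
    then show ?case using piece_child_subset[of "i mod 7" "j mod 7" n "i div 7" "j div 7"] by auto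
  qed simp
  moreover have "\<exists>i j. white m i j \<and> p \<in> piece m i j" if "p \<in> piece 0 0 0" for p m
  proof (induction m)
    case (Suc m)
    then show ?case using piece_in_child white_child by metis
  qed (use that in simp)
  ultimately show ?thesis unfolding mem_fractal subset_iff using piece_subset_cell by blast
qed

lemma fractal_eq_piece: "fractal = piece 0 0 0"
proof
  show "fractal \<subseteq> piece 0 0 0"
  proof
    fix p assume p: "p \<in> fractal"
    have "\<exists>i j. white (M - N) i j \<and> traced N (M - N) i j p" if "N \<le> M" for M N
      using that
    proof (induction N)
      case 0
      then show ?case using p by (simp add: mem_fractal)
    next
      case (Suc N)
      define n where "n = M - Suc N"
      have n: "M - N = Suc n" using Suc.prems by (simp add: n_def)
      from Suc obtain i j where "white (Suc n) i j" "traced N (Suc n) i j p"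
        unfolding n[symmetric] by auto
      then have "white n (i div 7) (j div 7) \<and> traced (Suc N) n (i div 7) (j div 7) p"
        unfolding traced.simps by (intro conjI exI[of _ "i mod 7"] exI[of _ "j mod 7"]) auto
      then show ?case unfolding n_def by blast
    qed
    from this[OF order_refl] show "p \<in> piece 0 0 0" by (auto simp: piece_def)
  qed
qed (rule piece_subset_fractal, simp)

text \<open>
  The left and right exits are in row 2 of 7 on every level, so the fractal meets a vertical side of
  the square at height \<open>2/7 + 2/49 + \<dots> = 1/3\<close>.
\<close>

lemma horizontal_exits_in_piece:
  assumes "u = real i \<or> u = real i + 1"
  shows "(u / 7 ^ n, (real j + 1 / 3) / 7 ^ n) \<in> piece n i j"
proof -
  have "traced N n i j (u / 7 ^ n, (real j + 1 / 3) / 7 ^ n)" for N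
    using assms
  proof (induction N arbitrary: n i j u)
    case (Suc N)
    define a where "a = (if u = real i then 0 else 6 :: nat)"
    have m: "marked a 2" by (simp add: a_def marked_left marked_right)
    have "7 * u = real (7 * i + a) \<or> 7 * u = real (7 * i + a) + 1"
      using Suc.prems by (auto simp: a_def)
    note Suc.IH[OF this, of "Suc n" "7 * j + 2"]
    moreover have "(real (7 * j + 2) + 1 / 3) / 7 ^ Suc n = (real j + 1 / 3) / 7 ^ n"
      by (simp add: field_simps)
    ultimately have "traced N (Suc n) (7 * i + a) (7 * j + 2) (u / 7 ^ n, (real j + 1 / 3) / 7 ^ n)"
      by simp
    with m show ?case unfolding traced.simps by blast
  qed (auto simp: mem_cell)
  then show ?thesis by (simp add: piece_def)
qed

lemma vertical_exits_in_piece: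
  assumes "u = real j \<or> u = real j + 1"
  shows "((real i + 1 / 3) / 7 ^ n, u / 7 ^ n) \<in> piece n i j"
proof -
  have "traced N n i j ((real i + 1 / 3) / 7 ^ n, u / 7 ^ n)" for N
    using assms
  proof (induction N arbitrary: n i j u)
    case (Suc N)
    define b where "b = (if u = real j then 0 else 6 :: nat)"
    have m: "marked 2 b" by (simp add: b_def marked_bottom marked_top)
    have "7 * u = real (7 * j + b) \<or> 7 * u = real (7 * j + b) + 1"
      using Suc.prems by (auto simp: b_def)
    note Suc.IH[OF this, of "Suc n" "7 * i + 2"]
    moreover have "(real (7 * i + 2) + 1 / 3) / 7 ^ Suc n = (real i + 1 / 3) / 7 ^ n"
      by (simp add: field_simps)
    ultimately have "traced N (Suc n) (7 * i + 2) (7 * j + b) ((real i + 1 / 3) / 7 ^ n, u / 7 ^ n)"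
      by simp
    with m show ?case unfolding traced.simps by blast
  qed (auto simp: mem_cell)
  then show ?thesis by (simp add: piece_def)
qed

lemma neighbouring_pieces_meet:
  assumes "neighbours (i, j) (i', j')"
  shows "piece n i j \<inter> piece n i' j' \<noteq> {}"
proof -
  from assms consider "i' = Suc i" "j = j'" | "i = Suc i'" "j = j'"
    | "i = i'" "j' = Suc j" | "i = i'" "j = Suc j'" by auto
  then show ?thesis
  proof cases
    case 1
    then show ?thesis using horizontal_exits_in_piece[of "real i'" i n j]
        horizontal_exits_in_piece[of "real i'" i' n j] by auto
  next
    case 2
    then show ?thesis using horizontal_exits_in_piece[of "real i" i n j]
        horizontal_exits_in_piece[of "real i" i' n j] by auto
  next
    case 3
    then show ?thesis using vertical_exits_in_piece[of "real j'" j i n]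
        vertical_exits_in_piece[of "real j'" j' i n] by auto
  next
    case 4
    then show ?thesis using vertical_exits_in_piece[of "real j" j i n]
        vertical_exits_in_piece[of "real j" j' i n] by auto
  qed
qed

definition share_piece :: "nat \<Rightarrow> (point \<times> point) set" where
  "share_piece n = {(x, y). \<exists>i j. white n i j \<and> x \<in> piece n i j \<and> y \<in> piece n i j}"

lemma share_piece_dist:
  assumes "(x, y) \<in> share_piece n"
  shows "dist x y \<le> 2 * (1 / 7) ^ n"
proof -
  obtain i j where ij: "x \<in> cell n i j" "y \<in> cell n i j"
    using assms piece_subset_cell unfolding share_piece_def by blast
  have "7 ^ n * \<bar>fst x - fst y\<bar> \<le> 1" "7 ^ n * \<bar>snd x - snd y\<bar> \<le> 1"
    using ij unfolding mem_cell by (auto simp: abs_if algebra_simps)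
  then have "\<bar>fst x - fst y\<bar> \<le> (1 / 7) ^ n" "\<bar>snd x - snd y\<bar> \<le> (1 / 7) ^ n"
    by (simp_all add: power_one_over field_simps)
  then show ?thesis using dist_le_coordinates[of x y] by simp
qed

text \<open>
  Every child is at most four steps away from the hub, and neighbouring children meet in an exit.
  So the two points are joined through the hub in \<open>4 + 1 + 4\<close> links.  Shorter connections are padded
  by repeating a point of the hub, which makes the number of links the same for all pairs.
\<close>

lemma share_piece_refine: "share_piece n \<subseteq> share_piece (Suc n) ^^ 9"
proof clarify
  fix x y assume "(x, y) \<in> share_piece n"
  then obtain i j where w: "white n i j" and x: "x \<in> piece n i j" and y: "y \<in> piece n i j"
    unfolding share_piece_def by blast
  define Q where "Q a b = piece (Suc n) (7 * i + a) (7 * j + b)" for a b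
  define R where "R = share_piece (Suc n)"
  have RI: "(p, p') \<in> R" if "marked a b" "p \<in> Q a b" "p' \<in> Q a b" for a b p p'
    using that white_child[OF w] unfolding R_def Q_def share_piece_def by blast
  \<comment> \<open>Both directions are kept because the second half of the chain leads from the hub to y.\<close>
  have to_hub: "\<exists>h\<in>Q 3 3. (p, h) \<in> R ^^ d \<and> (h, p) \<in> R ^^ d"
    if "marked a b" "p \<in> Q a b" "depth a b \<le> d" for a b p d
    using that
  proof (induction d arbitrary: a b p)
    case 0
    then show ?case using plan_hub[of a b] by auto
  next
    case (Suc d)
    obtain a' b' e where e: "marked a' b'" "depth a' b' \<le> d" "e \<in> Q a b" "e \<in> Q a' b'"
    proof (cases "depth a b = 0")
      case True
      then show ?thesis using that[of a b p] Suc.prems by simp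
    next
      case False
      then obtain a' b' where ab: "marked a' b'" "neighbours (a, b) (a', b')" "depth a' b' < depth a b"
        using plan_parent[OF Suc.prems(1)] by blast
      then have "neighbours (7 * i + a, 7 * j + b) (7 * i + a', 7 * j + b')" by auto
      from neighbouring_pieces_meet[OF this] obtain e where "e \<in> Q a b" "e \<in> Q a' b'"
        unfolding Q_def by blast
      then show ?thesis using that ab Suc.prems(3) by fastforce
    qed
    from Suc.IH[OF e(1,4,2)] obtain h where "h \<in> Q 3 3" "(e, h) \<in> R ^^ d" "(h, e) \<in> R ^^ d" by blast
    moreover have "(p, e) \<in> R" "(e, p) \<in> R" using RI Suc.prems(1,2) e(3) by blast+
    ultimately show ?case by (meson relpow_Suc_I relpow_Suc_I2)
  qed
  have hub: "marked 3 3" by (simp add: marked_def plan_def)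
  obtain a b where "marked a b" "x \<in> Q a b" using piece_in_child[OF x] unfolding Q_def by blast
  then obtain h where h: "h \<in> Q 3 3" "(x, h) \<in> R ^^ 4" using to_hub depth_le by metis
  obtain a b where "marked a b" "y \<in> Q a b" using piece_in_child[OF y] unfolding Q_def by blast
  then obtain h' where h': "h' \<in> Q 3 3" "(h', y) \<in> R ^^ 4" using to_hub depth_le by metis
  have "(x, h') \<in> R ^^ Suc 4" using h RI[OF hub h(1) h'(1)] by (meson relpow_Suc_I)
  then have "(x, y) \<in> R ^^ (Suc 4 + 4)" unfolding relpow_add using h'(2) by blast
  then show "(x, y) \<in> share_piece (Suc n) ^^ 9" by (simp add: R_def del: relpow.simps)
qed

lemma path_connected_fractal: "path_connected fractal"
  unfolding path_connected_def
proof (intro ballI)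
  fix x y assume xy: "x \<in> fractal" "y \<in> fractal"
  show "\<exists>g. path g \<and> path_image g \<subseteq> fractal \<and> pathstart g = x \<and> pathfinish g = y"
  proof (rule path_by_refinement[where R = share_piece and N = 9 and q = "1 / 7" and C = 2])
    show "share_piece n \<subseteq> fractal \<times> fractal" for n
      unfolding share_piece_def using piece_subset_fractal by blast
    show "(x, y) \<in> share_piece 0" "(y, y) \<in> share_piece 0"
      using xy unfolding share_piece_def fractal_eq_piece by auto
  qed (use closed_fractal share_piece_dist share_piece_refine in auto)
qed

section \<open>Flat maps on rectifiable paths\<close>

text \<open>
  For a partition fine enough, the images under \<open>\<Phi>\<close> of consecutive points of the path are at most
  \<open>\<epsilon>\<close> times their distance apart, so the images of the end points are at most \<open>\<epsilon>\<close> times the length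
  apart.
\<close>

lemma flat_map_constant_on_rectifiable_path:
  fixes g :: "real \<Rightarrow> 'a::metric_space" and \<Phi> :: "'a \<Rightarrow> 'b::metric_space"
  assumes g: "path g" "path_image g \<subseteq> L" "curve_length g \<noteq> \<infinity>"
    and flat: "\<And>\<epsilon>. \<epsilon> > 0 \<Longrightarrow>
      \<exists>\<eta>>0. \<forall>x\<in>L. \<forall>y\<in>L. dist x y < \<eta> \<longrightarrow> dist (\<Phi> x) (\<Phi> y) \<le> \<epsilon> * dist x y"
  shows "\<Phi> (pathstart g) = \<Phi> (pathfinish g)"
proof -
  obtain l where l: "curve_length g \<le> ereal l"
    using g(3) by (metis ereal_less_eq(1,2) ereal_cases order_refl)
  have poly: "(\<Sum>i<n. dist (g (t i)) (g (t (Suc i)))) \<le> l"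
    if "\<forall>i\<le>n. t i \<in> {0..1}" "\<forall>i<n. t i \<le> t (Suc i)" for n and t :: "nat \<Rightarrow> real"
  proof -
    have "ereal (\<Sum>i<n. dist (g (t i)) (g (t (Suc i)))) \<le> curve_length g"
      unfolding curve_length_def
      by (rule SUP_upper2[of "(n, t)"]) (use that in auto)
    also note l
    finally show ?thesis by simp
  qed
  have l0: "0 \<le> l" using poly[of 0 "\<lambda>_. 0"] by simp
  define D where "D = dist (\<Phi> (pathstart g)) (\<Phi> (pathfinish g))"
  have D: "D \<le> \<epsilon> * l" if e: "\<epsilon> > 0" for \<epsilon>
  proof -
    obtain \<eta> where \<eta>: "\<eta> > 0"
      "\<And>x y. x \<in> L \<Longrightarrow> y \<in> L \<Longrightarrow> dist x y < \<eta> \<Longrightarrow> dist (\<Phi> x) (\<Phi> y) \<le> \<epsilon> * dist x y"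
      using flat[OF e] by blast
    have "uniformly_continuous_on {0..1} g"
      using g(1) unfolding path_def by (intro compact_uniformly_continuous) auto
    then obtain \<delta> where \<delta>: "\<delta> > 0"
      "\<And>s t. s \<in> {0..1} \<Longrightarrow> t \<in> {0..1} \<Longrightarrow> dist t s < \<delta> \<Longrightarrow> dist (g t) (g s) < \<eta>"
      unfolding uniformly_continuous_on_def using \<eta>(1) by blast
    obtain n where n: "0 < n" "1 / real n < \<delta>"
      using \<delta>(1) by (metis nat_approx_posE inverse_eq_divide zero_less_Suc)
    define t where "t i = real i / real n" for i
    have t01: "t i \<in> {0..1}" if "i \<le> n" for i using that n by (auto simp: t_def field_simps)
    have gap: "t (Suc i) - t i = 1 / real n" for i
      by (simp add: t_def diff_divide_distrib[symmetric])
    have mono: "t i \<le> t (Suc i)" for i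
      using gap[of i] n by (metis diff_ge_0_iff_ge of_nat_0_le_iff zero_le_divide_1_iff)
    have gL: "g (t i) \<in> L" if "i \<le> n" for i
      using t01[OF that] g(2) by (auto simp: path_image_def)
    have step: "dist (\<Phi> (g (t i))) (\<Phi> (g (t (Suc i)))) \<le> \<epsilon> * dist (g (t i)) (g (t (Suc i)))"
      if "i < n" for i
    proof (rule \<eta>(2))
      have "dist (t i) (t (Suc i)) < \<delta>"
        using gap[of i] mono[of i] n by (simp add: dist_real_def)
      then show "dist (g (t i)) (g (t (Suc i))) < \<eta>"
        using that t01[of i] t01[of "Suc i"] by (intro \<delta>(2)) auto
    qed (use that gL in auto)
    have "t 0 = 0" "t n = 1" using n by (simp_all add: t_def)
    then have "D \<le> (\<Sum>i<n. dist (\<Phi> (g (t i))) (\<Phi> (g (t (Suc i)))))"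
      using dist_chain[of "\<lambda>i. \<Phi> (g (t i))" n] by (simp add: D_def pathstart_def pathfinish_def)
    also have "\<dots> \<le> (\<Sum>i<n. \<epsilon> * dist (g (t i)) (g (t (Suc i))))"
      by (intro sum_mono step) auto
    also have "\<dots> = \<epsilon> * (\<Sum>i<n. dist (g (t i)) (g (t (Suc i))))"
      by (simp add: sum_distrib_left)
    also have "\<dots> \<le> \<epsilon> * l"
      using e t01 mono by (intro mult_left_mono poly) auto
    finally show ?thesis .
  qed
  have "D \<le> 0"
  proof (rule ccontr)
    assume "\<not> D \<le> 0"
    \<comment> \<open>With this \<epsilon> the bound D \<le> \<epsilon> * l would give D \<le> D / 2.\<close>
    then have "D / (2 * (l + 1)) > 0" using l0 by simp
    from D[OF this] have "D * (l + 2) \<le> 0" using l0 by (simp add: field_simps)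
    then show False using \<open>\<not> D \<le> 0\<close> l0 by (simp add: mult_le_0_iff)
  qed
  then show ?thesis by (simp add: D_def)
qed

text \<open>
  For given \<open>x\<close> and \<open>y\<close>, the bound is applied at the last scale \<open>c * r ^ n\<close> that exceeds their
  distance.  The quotient of the two distances is then at most of order \<open>(q / r) ^ n\<close>, and \<open>n\<close> is large if
  the points are close.
\<close>

lemma flat_if_scaled_bounds:
  fixes \<Phi> :: "'a::metric_space \<Rightarrow> 'b::metric_space"
  assumes bound: "\<And>n x y. x \<in> L \<Longrightarrow> y \<in> L \<Longrightarrow> dist x y < c * r ^ n \<Longrightarrow> dist (\<Phi> x) (\<Phi> y) \<le> B * q ^ n"
    and c: "0 < c" and r: "0 < r" "r < 1" and q: "0 < q" "q < r" and e: "0 < \<epsilon>"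
  shows "\<exists>\<eta>>0. \<forall>x\<in>L. \<forall>y\<in>L. dist x y < \<eta> \<longrightarrow> dist (\<Phi> x) (\<Phi> y) \<le> \<epsilon> * dist x y"
proof -
  define B' where "B' = max B 0"
  have "(\<lambda>n. B' / (c * r) * (q / r) ^ n) \<longlonglongrightarrow> 0"
    using c q r by (auto intro!: tendsto_eq_intros LIMSEQ_power_zero)
  from order_tendstoD(2)[OF this e] obtain M where
    M: "\<And>n. n \<ge> M \<Longrightarrow> B' / (c * r) * (q / r) ^ n < \<epsilon>"
    unfolding eventually_sequentially by blast
  have "dist (\<Phi> x) (\<Phi> y) \<le> \<epsilon> * dist x y"
    if xy: "x \<in> L" "y \<in> L" "dist x y < c * r ^ M" for x y
  proof (cases "x = y")
    case False
    define P where "P n \<longleftrightarrow> c * r ^ n \<le> dist x y" for n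
    have "(\<lambda>n. c * r ^ n) \<longlonglongrightarrow> 0"
      using r by (auto intro!: tendsto_eq_intros LIMSEQ_power_zero)
    from order_tendstoD(2)[OF this, of "dist x y"] obtain n0 where n0: "P n0"
      using False unfolding eventually_sequentially P_def by (auto intro: less_imp_le)
    define n where "n = (LEAST n. P n) - 1"
    have "\<not> P 0"
    proof -
      have "c * r ^ M \<le> c * r ^ 0" using c r by (intro mult_left_mono power_decreasing) auto
      then show ?thesis using xy(3) unfolding P_def by linarith
    qed
    then have "(LEAST n. P n) \<noteq> 0" using LeastI[of P, OF n0] by metis
    then have Sn: "Suc n = (LEAST n. P n)" by (simp add: n_def)
    then have n: "P (Suc n)" "\<not> P n" using LeastI[of P, OF n0] not_less_Least[of n P] by auto
    have "M \<le> n"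
    proof (rule ccontr)
      assume "\<not> M \<le> n"
      then have "c * r ^ M \<le> c * r ^ Suc n" using c r by (intro mult_left_mono power_decreasing) auto
      then show False using xy(3) n(1) unfolding P_def by linarith
    qed
    have "dist (\<Phi> x) (\<Phi> y) \<le> B * q ^ n" using bound[OF xy(1,2)] n(2) by (simp add: P_def)
    also have "\<dots> \<le> B' * q ^ n" using q by (intro mult_right_mono) (auto simp: B'_def)
    also have "\<dots> = B' / (c * r) * (q / r) ^ n * (c * r ^ Suc n)"
      using c r q by (simp add: power_divide)
    also have "\<dots> \<le> \<epsilon> * (c * r ^ Suc n)"
      using M[OF \<open>M \<le> n\<close>] c r by (intro mult_right_mono) auto
    also have "\<dots> \<le> \<epsilon> * dist x y"
      using n(1) e by (simp add: P_def)
    finally show ?thesis .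
  qed simp
  moreover have "0 < c * r ^ M" using c r by simp
  ultimately show ?thesis by blast
qed

section \<open>Flat approximations of the identity\<close>

text \<open>
  How far along its arm the centre (for \<open>Centre\<close>) or a side of a square lies, in half squares counted
  from the hub: 0 at the hub, 8 at the outer end of the arm.  A side that leads nowhere counts
  like the centre.
\<close>

definition weight :: "nat \<Rightarrow> nat \<Rightarrow> dir \<Rightarrow> nat" where
  "weight a b d =
     (if d = inward a b then 2 * depth a b - 2
      else if d = outward a b then 2 * depth a b
      else 2 * depth a b - 1)"

text \<open>
  Two neighbouring white squares agree on the side between them.  The only neighbours on different
  arms are the hub and the first squares of the arms, whose inner sides have weight 0.
\<close>

lemma weight_horizontal:
  assumes "marked a b" "marked (Suc a) b"
  shows "weight a b East = weight (Suc a) b West \<and>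
    (arm a b = arm (Suc a) b \<or> weight a b East = 0)"
proof -
  have "marked a b \<Longrightarrow> marked (Suc a) b \<longrightarrow> weight a b East = weight (Suc a) b West \<and>
    (arm a b = arm (Suc a) b \<or> weight a b East = 0)"
    by (erule marked_all[rotated]) code_simp
  with assms show ?thesis by metis
qed

lemma weight_vertical:
  assumes "marked a b" "marked a (Suc b)"
  shows "weight a b North = weight a (Suc b) South \<and>
    (arm a b = arm a (Suc b) \<or> weight a b North = 0)"
proof -
  have "marked a b \<Longrightarrow> marked a (Suc b) \<longrightarrow> weight a b North = weight a (Suc b) South \<and>
    (arm a b = arm a (Suc b) \<or> weight a b North = 0)"
    by (erule marked_all[rotated]) code_simp
  with assms show ?thesis by metis
qed

lemma weight_Centre:
  assumes "marked a b"
  shows "weight a b Centre \<le> 8" "\<bar>int (weight a b d) - int (weight a b Centre)\<bar> \<le> 1"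
proof -
  show "weight a b Centre \<le> 8"
    using assms by (rule marked_all[rotated]) code_simp
  have "\<forall>d\<in>set [Centre, East, North, West, South]. \<bar>int (weight a b d) - int (weight a b Centre)\<bar> \<le> 1"
    using assms by (rule marked_all[rotated]) code_simp
  then show "\<bar>int (weight a b d) - int (weight a b Centre)\<bar> \<le> 1"
    by (cases d) auto
qed

lemma weight_exits:
  "arm 6 2 = East" "weight 6 2 East = 8" "arm 0 2 = West" "weight 0 2 West = 8"
  "arm 2 6 = North" "weight 2 6 North = 8" "arm 2 0 = South" "weight 2 0 South = 8"
  by code_simp+

text \<open>
  From the values \<open>v\<close> of a square at its centre and at its four sides, the values of its child in
  column \<open>a\<close> and row \<open>b\<close>: linear interpolation along the arms.
\<close>

definition blend :: "nat \<Rightarrow> nat \<Rightarrow> (dir \<Rightarrow> point) \<Rightarrow> dir \<Rightarrow> point" where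
  "blend a b v d = v Centre + (real (weight a b d) / 8) *\<^sub>R (v (arm a b) - v Centre)"

fun offset :: "dir \<Rightarrow> point" where
  "offset Centre = (1 / 2, 1 / 2)"
| "offset East = (1, 1 / 2)"
| "offset North = (1 / 2, 1)"
| "offset West = (0, 1 / 2)"
| "offset South = (1 / 2, 0)"

text \<open>
  On level \<open>k\<close> the true centres and side midpoints; on level \<open>k + n\<close> the values interpolated from
  them \<open>n\<close> times.
\<close>

primrec vertex :: "nat \<Rightarrow> nat \<Rightarrow> nat \<Rightarrow> nat \<Rightarrow> dir \<Rightarrow> point" where
  "vertex k 0 i j = (\<lambda>d. (1 / 7 ^ k) *\<^sub>R ((real i, real j) + offset d))"
| "vertex k (Suc n) i j = blend (i mod 7) (j mod 7) (vertex k n (i div 7) (j div 7))"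

lemma blend_outer_exits:
  "marked 6 b \<Longrightarrow> blend 6 b v East = v East" "marked 0 b \<Longrightarrow> blend 0 b v West = v West"
  "marked a 6 \<Longrightarrow> blend a 6 v North = v North" "marked a 0 \<Longrightarrow> blend a 0 v South = v South"
  by (simp_all add: marked_left marked_right marked_top marked_bottom blend_def weight_exits)

lemma blend_inner_exits:
  "marked a b \<Longrightarrow> marked (Suc a) b \<Longrightarrow> blend a b v East = blend (Suc a) b v West"
  "marked a b \<Longrightarrow> marked a (Suc b) \<Longrightarrow> blend a b v North = blend a (Suc b) v South"
  using weight_horizontal[of a b] weight_vertical[of a b] by (auto simp: blend_def)

text \<open>
  The values belong to the common side rather than to one of its two squares.  If the squares
  have different parents, then they are exits of these, and their values at the common side are
  the values of the parents, which agree by induction.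
\<close>

lemma vertex_East_West:
  "white (k + n) i j \<Longrightarrow> white (k + n) (Suc i) j \<Longrightarrow> vertex k n i j East = vertex k n (Suc i) j West"
proof (induction n arbitrary: i j)
  case (Suc n)
  show ?case
  proof (cases "Suc (i mod 7) = 7")
    case True
    then have "Suc i div 7 = Suc (i div 7)" "Suc i mod 7 = 0" "i mod 7 = 6"
      by (simp_all add: div_Suc mod_Suc)
    then show ?thesis using Suc by (simp add: blend_outer_exits)
  next
    case False
    then have "Suc i div 7 = i div 7" "Suc i mod 7 = Suc (i mod 7)"
      by (simp_all add: div_Suc mod_Suc)
    then show ?thesis using Suc.prems by (simp add: blend_inner_exits)
  qed
qed simp

lemma vertex_North_South:
  "white (k + n) i j \<Longrightarrow> white (k + n) i (Suc j) \<Longrightarrow> vertex k n i j North = vertex k n i (Suc j) South"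
proof (induction n arbitrary: i j)
  case (Suc n)
  show ?case
  proof (cases "Suc (j mod 7) = 7")
    case True
    then have "Suc j div 7 = Suc (j div 7)" "Suc j mod 7 = 0" "j mod 7 = 6"
      by (simp_all add: div_Suc mod_Suc)
    then show ?thesis using Suc by (simp add: blend_outer_exits)
  next
    case False
    then have "Suc j div 7 = j div 7" "Suc j mod 7 = Suc (j mod 7)"
      by (simp_all add: div_Suc mod_Suc)
    then show ?thesis using Suc.prems by (simp add: blend_inner_exits)
  qed
qed simp

text \<open>
  The centre of a child and its sides are at most one half square apart, on an arm of 8 half squares.
\<close>

lemma blend_contracts:
  assumes "marked a b" and r: "\<And>d. dist (v Centre) (v d) \<le> r"
  shows "dist (blend a b v Centre) (blend a b v d) \<le> r / 8"
    and "dist (v Centre) (blend a b v Centre) \<le> r"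
proof -
  define w where "w = v (arm a b) - v Centre"
  have w: "norm w \<le> r" using r[of "arm a b"] by (simp add: w_def dist_norm norm_minus_commute)
  then have r0: "0 \<le> r" using norm_ge_zero order_trans by blast
  have "\<bar>real (weight a b d) - real (weight a b Centre)\<bar> \<le> 1"
    using weight_Centre(2)[OF assms(1), of d] by linarith
  then have "\<bar>real (weight a b Centre) / 8 - real (weight a b d) / 8\<bar> \<le> 1 / 8"
    by linarith
  from mult_mono[OF this w] have
    "norm ((real (weight a b Centre) / 8 - real (weight a b d) / 8) *\<^sub>R w) \<le> r / 8"
    by simp
  then show "dist (blend a b v Centre) (blend a b v d) \<le> r / 8"
    by (simp add: blend_def dist_norm w_def[symmetric] scaleR_left_diff_distrib)
  have "\<bar>real (weight a b Centre) / 8\<bar> \<le> 1" using weight_Centre(1)[OF assms(1)] by simp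
  from mult_mono[OF this w] show "dist (v Centre) (blend a b v Centre) \<le> r"
    by (simp add: blend_def dist_norm w_def[symmetric])
qed

lemma vertex_radius:
  "white (k + n) i j \<Longrightarrow> dist (vertex k n i j Centre) (vertex k n i j d) \<le> (1 / 2) / 7 ^ k * (1 / 8) ^ n"
proof (induction n arbitrary: i j d)
  case 0
  have "norm (offset Centre - offset d) \<le> 1 / 2"
    by (cases d) (simp_all add: norm_Pair)
  then have "(1 / 7 ^ k) * norm (offset Centre - offset d) \<le> (1 / 7 ^ k) * (1 / 2)"
    by (intro mult_left_mono) auto
  moreover have "vertex k 0 i j Centre - vertex k 0 i j d = (1 / 7 ^ k) *\<^sub>R (offset Centre - offset d)"
    by (simp add: scaleR_diff_right[symmetric] del: offset.simps)
  ultimately show ?case by (simp add: dist_norm del: vertex.simps offset.simps)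
next
  case (Suc n)
  then have "marked (i mod 7) (j mod 7)" "white (k + n) (i div 7) (j div 7)" by simp_all
  from blend_contracts(1)[where v = "vertex k n (i div 7) (j div 7)", OF this(1) Suc.IH[OF this(2)]]
  show ?case by simp
qed

lemma neighbouring_centres:
  assumes "white (k + n) i j" "white (k + n) i' j'" "(i, j) = (i', j') \<or> neighbours (i, j) (i', j')"
  shows "dist (vertex k n i j Centre) (vertex k n i' j' Centre) \<le> 1 / 7 ^ k * (1 / 8) ^ n"
proof -
  have shared: ?thesis if "vertex k n i j d = vertex k n i' j' d'" for d d'
    using vertex_radius[OF assms(1), of d] vertex_radius[OF assms(2), of d'] that
      dist_triangle2[of "vertex k n i j Centre" "vertex k n i' j' Centre" "vertex k n i j d"] by simp
  from assms(3) consider "i = i'" "j = j'" | "i' = Suc i" "j = j'" | "i = Suc i'" "j = j'"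
    | "i = i'" "j' = Suc j" | "i = i'" "j = Suc j'" by auto
  then show ?thesis
  proof cases
    case 1 then show ?thesis by simp
  next
    case 2 then show ?thesis using shared vertex_East_West assms by blast
  next
    case 3 then show ?thesis using shared vertex_East_West[symmetric] assms by blast
  next
    case 4 then show ?thesis using shared vertex_North_South assms by blast
  next
    case 5 then show ?thesis using shared vertex_North_South[symmetric] assms by blast
  qed
qed

text \<open>
  The two squares of level \<open>n + 1\<close> are so close that they touch.  If their parents touched in a
  corner only, then the squares would be corner squares of their parents, but these are black.
\<close>

lemma close_white_cells_have_neighbouring_parents:
  assumes w: "white (Suc n) i j" "white (Suc n) i' j'"
    and x: "x \<in> cell (Suc n) i j" and y: "y \<in> cell (Suc n) i' j'" and d: "dist x y < 1 / 7 ^ Suc n"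
  shows "(i div 7, j div 7) = (i' div 7, j' div 7) \<or> neighbours (i div 7, j div 7) (i' div 7, j' div 7)"
proof -
  have "\<bar>fst x - fst y\<bar> < 1 / 7 ^ Suc n" "\<bar>snd x - snd y\<bar> < 1 / 7 ^ Suc n"
    using dist_fst_le[of x y] dist_snd_le[of x y] d by (simp_all add: dist_real_def)
  then have "\<bar>7 ^ Suc n * fst x - 7 ^ Suc n * fst y\<bar> < 1" "\<bar>7 ^ Suc n * snd x - 7 ^ Suc n * snd y\<bar> < 1"
    by (simp_all add: abs_less_iff field_simps)
  with x y have "real i < real i' + 2 \<and> real i' < real i + 2 \<and> real j < real j' + 2 \<and> real j' < real j + 2"
    unfolding mem_cell by linarith
  then have c: "i \<le> Suc i'" "i' \<le> Suc i" "j \<le> Suc j'" "j' \<le> Suc j" by linarith+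
  have "a div 7 = b div 7 \<or> ((b div 7 = Suc (a div 7) \<or> a div 7 = Suc (b div 7)) \<and> (a mod 7 = 0 \<or> a mod 7 = 6))"
    if "a \<le> Suc b" "b \<le> Suc a" for a b :: nat
  proof -
    from that consider "a = b" | "b = Suc a" | "a = Suc b" by linarith
    then show ?thesis by cases (auto simp: div_Suc mod_Suc)
  qed
  from this[OF c(1,2)] this[OF c(3,4)] show ?thesis
    using w(1) marked_left marked_right by fastforce
qed

text \<open>
  For \<open>x\<close> in the fractal, \<open>\<Phi> x\<close> is the limit of the interpolated centre values of white squares
  around \<open>x\<close>.  To have \<open>close_white_cells_have_neighbouring_parents\<close> at hand, the square of level
  \<open>k + n\<close> is obtained as the parent of a white square of level \<open>k + n + 1\<close> that contains \<open>x\<close>.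
\<close>

lemma flat_approximation_of_identity:
  "\<exists>\<Phi> :: point \<Rightarrow> point. (\<forall>x\<in>fractal. dist (\<Phi> x) x \<le> 3 / 7 ^ k) \<and>
    (\<forall>n. \<forall>x\<in>fractal. \<forall>y\<in>fractal. dist x y < 1 / 7 ^ Suc (k + n) \<longrightarrow>
        dist (\<Phi> x) (\<Phi> y) \<le> 5 / 7 ^ k * (1 / 8) ^ n)"
proof -
  define C where "C n s = vertex k n (fst s div 7) (snd s div 7) Centre" for n s
  define covers where "covers n x s \<longleftrightarrow> white (Suc (k + n)) (fst s) (snd s) \<and> x \<in> cell (Suc (k + n)) (fst s) (snd s)"
    for n x s
  define s where "s n x = (SOME s. covers n x s)" for n x
  have s: "covers n x (s n x)" if "x \<in> fractal" for n x
  proof -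
    obtain i j where "white (Suc (k + n)) i j" "x \<in> cell (Suc (k + n)) i j"
      using \<open>x \<in> fractal\<close> unfolding mem_fractal by blast
    then have "covers n x (i, j)" by (simp add: covers_def)
    then show ?thesis unfolding s_def by (rule someI)
  qed
  have close: "dist (C n p) (C n p') \<le> 1 / 7 ^ k * (1 / 8) ^ n"
    if "covers n x p" "covers n y p'" "dist x y < 1 / 7 ^ Suc (k + n)" for n x y p p'
    using that close_white_cells_have_neighbouring_parents[of "k + n" "fst p" "snd p" "fst p'" "snd p'" x y]
    unfolding C_def covers_def by (intro neighbouring_centres) auto
  have step: "dist (C n (s n x)) (C (Suc n) (s (Suc n) x)) \<le> (3 / 2) / 7 ^ k * (1 / 8) ^ n"
    if x: "x \<in> fractal" for n x
  proof -
    \<comment> \<open>The square used for x on level k + n + 1 is itself a white square around x.  Its parent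
        serves to compare the values of the levels k + n and k + n + 1.\<close>
    define p where "p = (fst (s (Suc n) x) div 7, snd (s (Suc n) x) div 7)"
    have p: "covers n x p"
      using s[OF x, of "Suc n"] cell_parent unfolding covers_def p_def by auto
    then have "marked (fst p mod 7) (snd p mod 7)" "white (k + n) (fst p div 7) (snd p div 7)"
      by (simp_all add: covers_def)
    from blend_contracts(2)[where v = "vertex k n (fst p div 7) (snd p div 7)",
        OF this(1) vertex_radius[OF this(2)]]
    have "dist (C n p) (C (Suc n) (s (Suc n) x)) \<le> (1 / 2) / 7 ^ k * (1 / 8) ^ n"
      by (simp add: C_def p_def)
    moreover have "dist (C n (s n x)) (C n p) \<le> 1 / 7 ^ k * (1 / 8) ^ n"
      by (rule close[OF s[OF x] p]) simp
    ultimately show ?thesis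
      using dist_triangle[of "C n (s n x)" "C (Suc n) (s (Suc n) x)" "C n p"] by simp
  qed
  \<comment> \<open>The geometric series with first term 3/2 and ratio 1/8 has the sum 12/7, which is below 2.\<close>
  have "\<exists>l. \<forall>n. dist (C n (s n x)) l \<le> 2 / 7 ^ k * (1 / 8) ^ n" if x: "x \<in> fractal" for x
  proof -
    have le: "(3 / 2) / 7 ^ k / (1 - 1 / 8) * (1 / 8) ^ n \<le> 2 / 7 ^ k * (1 / 8 :: real) ^ n" for n
      by (intro mult_right_mono) (simp_all add: field_simps)
    show ?thesis
    proof (rule geometric_limit[of "1 / 8" "\<lambda>n. C n (s n x)", OF _ _ step[OF x]])
      fix l assume "\<And>n. dist (C n (s n x)) l \<le> (3 / 2) / 7 ^ k / (1 - 1 / 8) * (1 / 8) ^ n"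
      then show ?thesis using le order_trans by blast
    qed simp_all
  qed
  then obtain \<Phi> where \<Phi>: "\<And>x n. x \<in> fractal \<Longrightarrow> dist (C n (s n x)) (\<Phi> x) \<le> 2 / 7 ^ k * (1 / 8) ^ n"
    using bchoice[of fractal "\<lambda>x l. \<forall>n. dist (C n (s n x)) l \<le> 2 / 7 ^ k * (1 / 8) ^ n"] by blast
  have "dist (\<Phi> x) x \<le> 3 / 7 ^ k" if x: "x \<in> fractal" for x
  proof -
    define i j where "i = fst (s 0 x) div 7" and "j = snd (s 0 x) div 7"
    have "x \<in> cell k i j"
      using s[OF x, of 0] cell_parent by (simp add: covers_def i_def j_def)
    then have "\<bar>7 ^ k * fst x - (real i + 1 / 2)\<bar> \<le> 1 / 2" "\<bar>7 ^ k * snd x - (real j + 1 / 2)\<bar> \<le> 1 / 2"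
      unfolding mem_cell abs_le_iff by linarith+
    then have "\<bar>(real i + 1 / 2) / 7 ^ k - fst x\<bar> \<le> (1 / 2) / 7 ^ k"
        "\<bar>(real j + 1 / 2) / 7 ^ k - snd x\<bar> \<le> (1 / 2) / 7 ^ k"
      by (simp_all add: abs_le_iff field_simps)
    then have "dist (C 0 (s 0 x)) x \<le> 1 / 7 ^ k"
      using dist_le_coordinates[of "C 0 (s 0 x)" x]
      by (simp add: C_def i_def[symmetric] j_def[symmetric])
    then show ?thesis
      using \<Phi>[OF x, of 0] dist_triangle[of "\<Phi> x" x "C 0 (s 0 x)"] by (simp add: dist_commute)
  qed
  moreover have "dist (\<Phi> x) (\<Phi> y) \<le> 5 / 7 ^ k * (1 / 8) ^ n"
    if "x \<in> fractal" "y \<in> fractal" "dist x y < 1 / 7 ^ Suc (k + n)" for n x y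
    using \<Phi>[OF that(1), of n] \<Phi>[OF that(2), of n] close[OF s[OF that(1)] s[OF that(2)] that(3)]
      dist_triangle[of "\<Phi> x" "\<Phi> y" "C n (s n x)"]
      dist_triangle[of "C n (s n x)" "\<Phi> y" "C n (s n y)"]
    by (simp add: dist_commute)
  ultimately show ?thesis by blast
qed

lemma rectifiable_path_in_fractal_closed:
  assumes g: "path g" "path_image g \<subseteq> fractal" "curve_length g \<noteq> \<infinity>"
  shows "pathstart g = pathfinish g"
proof (rule ccontr)
  define p where "p = pathstart g"
  define q where "q = pathfinish g"
  have pq: "p \<in> fractal" "q \<in> fractal" using g(2) by (auto simp: p_def q_def)
  assume "pathstart g \<noteq> pathfinish g"
  then have "0 < dist p q" by (simp add: p_def q_def)
  moreover have "(\<lambda>k. 6 * (1 / 7 :: real) ^ k) \<longlonglongrightarrow> 0"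
    by (auto intro!: tendsto_eq_intros LIMSEQ_power_zero)
  ultimately obtain k where k: "6 * (1 / 7) ^ k < dist p q"
    using order_tendstoD(2) by (metis eventually_happens' sequentially_bot)
  obtain \<Phi> :: "point \<Rightarrow> point" where near: "\<And>x. x \<in> fractal \<Longrightarrow> dist (\<Phi> x) x \<le> 3 / 7 ^ k" and
    small: "\<And>n x y. x \<in> fractal \<Longrightarrow> y \<in> fractal \<Longrightarrow> dist x y < 1 / 7 ^ Suc (k + n) \<Longrightarrow>
        dist (\<Phi> x) (\<Phi> y) \<le> 5 / 7 ^ k * (1 / 8) ^ n"
    using flat_approximation_of_identity[of k] by blast
  have "\<Phi> p = \<Phi> q"
    unfolding p_def q_def using g
  proof (rule flat_map_constant_on_rectifiable_path)
    fix \<epsilon> :: real assume "\<epsilon> > 0"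
    show "\<exists>\<eta>>0. \<forall>x\<in>fractal. \<forall>y\<in>fractal. dist x y < \<eta> \<longrightarrow> dist (\<Phi> x) (\<Phi> y) \<le> \<epsilon> * dist x y"
    proof (rule flat_if_scaled_bounds[where c = "1 / 7 ^ Suc k" and r = "1 / 7" and q = "1 / 8"])
      show "dist (\<Phi> x) (\<Phi> y) \<le> 5 / 7 ^ k * (1 / 8) ^ n"
        if "x \<in> fractal" "y \<in> fractal" "dist x y < 1 / 7 ^ Suc k * (1 / 7) ^ n" for n x y
        using small[OF that(1,2), of n] that(3) by (simp add: power_add power_divide)
    qed (use \<open>\<epsilon> > 0\<close> in auto)
  qed
  then have "dist p q \<le> 6 / 7 ^ k"
    using near[OF pq(1)] near[OF pq(2)] dist_triangle3[of p q "\<Phi> p"] by simp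
  with k show False by (simp add: power_divide)
qed

theorem proposition4:
  shows "\<exists>(m :: nat \<Rightarrow> nat) (A :: nat \<Rightarrow> sq set).
    (\<forall>k. labyrinth_pattern (m k) (A k) \<and>
         horizontally_blocked (m k) (A k) \<and> vertically_blocked (m k) (A k)) \<and>
    (\<forall>p\<in>limit_set A. \<forall>q\<in>limit_set A. p \<noteq> q \<longrightarrow>
       (\<exists>g. arc_between (limit_set A) p q g) \<and>
       (\<forall>g. arc_between (limit_set A) p q g \<longrightarrow> curve_length g = \<infinity>))"
proof (intro exI[of _ "\<lambda>_. 7"] exI[of _ "\<lambda>_. windmill"] conjI allI ballI impI)
  fix p q assume pq: "p \<in> fractal" "q \<in> fractal" "p \<noteq> q"
  show "\<exists>g. arc_between fractal p q g"
    using path_connected_fractal pq unfolding path_connected_arcwise arc_between_def by blast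
  fix g assume g: "arc_between fractal p q g"
  show "curve_length g = \<infinity>"
  proof (rule ccontr)
    assume "curve_length g \<noteq> \<infinity>"
    then have "pathstart g = pathfinish g"
      using g rectifiable_path_in_fractal_closed[of g] by (auto simp: arc_between_def arc_imp_path)
    then show False using g pq(3) unfolding arc_between_def by metis
  qed
qed (rule windmill_labyrinth)+

end
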